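(* Let $\gamma\colon[0,+\infty)\to\mathbb{R}^2$ be the interpolating curve of the sequence $\{x_i\}_{i\ge2}$ and let $\mu_{\gamma|_{[0,N]}}$, $N\in\mathbb{N}$, $N\geq 1$, be the associated probability measures on $\mathbb{R}^2\times\mathbb{R}^2$, all as defined in the context. Then, in the weak* topology, the set of limit points of the sequence $\{\mu_{\gamma|_{[0,N]}}\}_N$ consists exactly of all the measures $$\mu^{\theta_0}=\int_{\theta_0-2\pi}^{\theta_0}\frac{\delta_{(r(\theta),r(\theta))}+\delta_{(r(\theta),-r(\theta))}}{2}\,\frac{e^{\theta-\theta_0}}{1-e^{-2\pi}}\,d\theta,\qquad\theta_0\in\mathbb{R},$$ where $r(\theta)=(\cos\theta,\sin\theta)$ and $\delta_{(u,v)}$ denotes the Dirac delta on $\mathbb{R}^2\times\mathbb{R}^2$ concentrated at $(u,v)$. In particular, the set of limit points is uncountable.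
   Context: For integers $i\ge2$ let $$x_i=\Big(1+\tfrac{(-1)^i}{i}\Big)(\cos\vartheta_i,\sin\vartheta_i),\qquad \vartheta_i=\sum_{k=2}^i\frac1{k\log k},\qquad \varepsilon_i=\|x_{i+1}-x_i\|.$$ Let $t_i=\sum_{j=2}^{i-1}\varepsilon_j$ (so $t_2=0$ and $t_i\to+\infty$). The interpolating curve $\gamma\colon[0,+\infty)\to\mathbb{R}^2$ is the continuous curve with $\gamma(t_i)=x_i$ that is affine on each interval $[t_i,t_{i+1}]$, so that $\gamma'(t)=(x_{i+1}-x_i)/\varepsilon_i$ for $t_i<t<t_{i+1}$. For a bounded measurable set $B\subset[0,+\infty)$ of positive Lebesgue measure $|B|$, $\mu_{\gamma|_B}=\frac1{|B|}(\gamma,\gamma')_*\mathsf{Leb}_B$, where $\mathsf{Leb}_B$ is Lebesgue measure on $B$ and $*$ denotes pushforward; i.e. $\int\varphi\,d\mu_{\gamma|_B}=\frac1{|B|}\int_B\varphi(\gamma(t),\gamma'(t))\,dt$ for bounded measurable $\varphi\colon\mathbb{R}^2\times\mathbb{R}^2\to\mathbb{R}$. *)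

theory Defs
  imports "HOL-Probability.Probability"
begin

section \<open>The sequence and its interpolating curve\<close>

definition unit_vec :: "real \<Rightarrow> real ^ 2" where
  "unit_vec \<theta> = vector [cos \<theta>, sin \<theta>]"

definition angle :: "nat \<Rightarrow> real" where
  "angle i = (\<Sum>k=2..i. 1 / (real k * ln (real k)))"

definition spiral :: "nat \<Rightarrow> real ^ 2" where
  "spiral i = (1 + (-1) ^ i / real i) *\<^sub>R unit_vec (angle i)"

text \<open>Sequences are indexed by \<open>i \<ge> 2\<close>; values at \<open>0\<close> and \<open>1\<close> play no role.\<close>

definition step :: "(nat \<Rightarrow> 'a::real_normed_vector) \<Rightarrow> nat \<Rightarrow> real" where
  "step x i = norm (x (Suc i) - x i)"

definition knot :: "(nat \<Rightarrow> 'a::real_normed_vector) \<Rightarrow> nat \<Rightarrow> real" where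
  "knot x i = (\<Sum>j=2..<i. step x j)"

text \<open>Meaningful for \<open>t \<ge> 0\<close>, when the steps are positive and the knots tend to infinity:
  then the intervals \<open>[knot x i, knot x (i + 1))\<close>, \<open>i \<ge> 2\<close>, partition \<open>[0, \<infinity>)\<close>.\<close>

definition piece :: "(nat \<Rightarrow> 'a::real_normed_vector) \<Rightarrow> real \<Rightarrow> nat" where
  "piece x t = (THE i. 2 \<le> i \<and> knot x i \<le> t \<and> t < knot x (Suc i))"

definition interp_curve :: "(nat \<Rightarrow> 'a::real_normed_vector) \<Rightarrow> real \<Rightarrow> 'a" where
  "interp_curve x t =
     (let i = piece x t
      in x i + ((t - knot x i) / step x i) *\<^sub>R (x (Suc i) - x i))"

lemma interp_curve_eq:
  assumes pos: "\<And>j. j \<ge> 2 \<Longrightarrow> step x j > 0"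
    and i: "2 \<le> i" "knot x i \<le> t" "t < knot x (Suc i)"
  shows "interp_curve x t = x i + ((t - knot x i) / step x i) *\<^sub>R (x (Suc i) - x i)"
proof -
  have mono: "knot x m \<le> knot x n" if "m \<le> n" for m n
    unfolding knot_def
    by (rule sum_mono2) (use that pos in \<open>auto intro: less_imp_le\<close>)
  have "piece x t = i"
    unfolding piece_def
  proof (rule the_equality)
    fix j assume j: "2 \<le> j \<and> knot x j \<le> t \<and> t < knot x (Suc j)"
    show "j = i"
      using mono[of "Suc i" j] mono[of "Suc j" i] i j by (cases i j rule: linorder_cases) auto
  qed (use i in auto)
  then show ?thesis
    by (simp add: interp_curve_def)
qed

section \<open>Measures\<close>

text \<open>The derivative of an interpolating curve may fail to exist at the knots, where
  \<^const>\<open>vector_derivative\<close> takes an unspecified value; the knots form a null set.\<close>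

definition curve_measure ::
  "(real \<Rightarrow> 'a::euclidean_space) \<Rightarrow> real set \<Rightarrow> ('a \<times> 'a) measure" where
  "curve_measure \<gamma> B =
     distr (uniform_measure lborel B) borel (\<lambda>t. (\<gamma> t, vector_derivative \<gamma> (at t)))"

definition limit_measure :: "real \<Rightarrow> ((real ^ 2) \<times> (real ^ 2)) measure" where
  "limit_measure \<theta>\<^sub>0 = measure_of UNIV (sets borel)
     (\<lambda>A. \<integral>\<^sup>+ \<theta>\<in>{\<theta>\<^sub>0 - 2 * pi..\<theta>\<^sub>0}.
        (emeasure (return borel (unit_vec \<theta>, unit_vec \<theta>)) A
          + emeasure (return borel (unit_vec \<theta>, - unit_vec \<theta>)) A) / 2
        * ennreal (exp (\<theta> - \<theta>\<^sub>0) / (1 - exp (- 2 * pi))) \<partial>lborel)"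

lemma borel_measurable_unit_vec [measurable]: "unit_vec \<in> borel_measurable borel"
proof -
  have "continuous_on UNIV (\<lambda>\<theta>. \<chi> i. if i = 1 then cos \<theta> else sin \<theta> :: real ^ 2)"
  proof (rule continuous_on_vec_lambda)
    show "continuous_on UNIV (\<lambda>\<theta>::real. if i = 1 then cos \<theta> else sin \<theta>)" for i :: 2
      by (cases "i = 1") (auto intro!: continuous_intros)
  qed
  moreover have "(\<lambda>\<theta>. \<chi> i. if i = 1 then cos \<theta> else sin \<theta> :: real ^ 2) = unit_vec"
    by (auto simp: unit_vec_def vec_eq_iff forall_2)
  ultimately show ?thesis
    using borel_measurable_continuous_onI by metis
qed

lemma sets_limit_measure [simp]: "sets (limit_measure \<theta>\<^sub>0) = sets borel"
  unfolding limit_measure_def using sets.sigma_sets_eq[of borel] by simp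

lemma emeasure_limit_measure:
  assumes "A \<in> sets borel"
  shows "emeasure (limit_measure \<theta>\<^sub>0) A =
    (\<integral>\<^sup>+ \<theta>\<in>{\<theta>\<^sub>0 - 2 * pi..\<theta>\<^sub>0}.
        (emeasure (return borel (unit_vec \<theta>, unit_vec \<theta>)) A
          + emeasure (return borel (unit_vec \<theta>, - unit_vec \<theta>)) A) / 2
        * ennreal (exp (\<theta> - \<theta>\<^sub>0) / (1 - exp (- 2 * pi))) \<partial>lborel)"
proof (rule emeasure_measure_of[OF limit_measure_def])
  let ?k = "\<lambda>\<theta> A. (emeasure (return borel (unit_vec \<theta>, unit_vec \<theta>)) A
          + emeasure (return borel (unit_vec \<theta>, - unit_vec \<theta>)) A) / 2
        * ennreal (exp (\<theta> - \<theta>\<^sub>0) / (1 - exp (- 2 * pi))) * indicator {\<theta>\<^sub>0 - 2 * pi..\<theta>\<^sub>0} \<theta>"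
  let ?\<mu> = "\<lambda>A. \<integral>\<^sup>+ \<theta>. ?k \<theta> A \<partial>lborel"
  show "A \<in> sets (limit_measure \<theta>\<^sub>0)"
    using assms by simp
  show "sets borel \<subseteq> Pow UNIV"
    by simp
  show "positive (sets (limit_measure \<theta>\<^sub>0)) ?\<mu>"
    by (simp add: positive_def)
  show "countably_additive (sets (limit_measure \<theta>\<^sub>0)) ?\<mu>"
  proof (rule countably_additiveI)
    fix B :: "nat \<Rightarrow> ((real ^ 2) \<times> (real ^ 2)) set"
    assume "range B \<subseteq> sets (limit_measure \<theta>\<^sub>0)" and disj: "disjoint_family B"
    then have B [measurable]: "B n \<in> sets borel" for n
      by auto
    have k: "(\<Sum>n. ?k \<theta> (B n)) = ?k \<theta> (\<Union>n. B n)" for \<theta>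
    proof -
      have "(\<Sum>n. emeasure (return borel v) (B n)) = emeasure (return borel v) (\<Union>n. B n)"
        for v :: "(real ^ 2) \<times> (real ^ 2)"
        by (rule suminf_emeasure) (use disj B in auto)
      then show ?thesis
        by (simp add: divide_ennreal_def suminf_add[symmetric])
    qed
    have "(\<Sum>n. ?\<mu> (B n)) = (\<integral>\<^sup>+ \<theta>. (\<Sum>n. ?k \<theta> (B n)) \<partial>lborel)"
      by (subst nn_integral_suminf) (auto simp: emeasure_return)
    then show "(\<Sum>n. ?\<mu> (B n)) = ?\<mu> (\<Union>n. B n)"
      unfolding k .
  qed
qed

section \<open>The weak* topology\<close>

text \<open>Finite Borel measures form the positive cone of the dual of \<open>C\<^sub>0\<close>, the space of
  continuous functions vanishing at infinity.\<close>

definition C\<^sub>0 :: "('a::euclidean_space \<Rightarrow> real) set" where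
  "C\<^sub>0 = {\<phi>. continuous_on UNIV \<phi> \<and> (\<phi> \<longlongrightarrow> 0) at_infinity}"

definition weak_star_topology :: "'a::euclidean_space measure topology" where
  "weak_star_topology =
     pullback_topology {M. sets M = sets borel \<and> finite_measure M}
       (\<lambda>M. \<lambda>\<phi>\<in>C\<^sub>0. \<integral>x. \<phi> x \<partial>M) (powertop_real C\<^sub>0)"

definition limit_points :: "'a topology \<Rightarrow> (nat \<Rightarrow> 'a) \<Rightarrow> 'a set" where
  "limit_points T f =
     {l. \<exists>s::nat \<Rightarrow> nat. strict_mono s \<and> limitin T (f \<circ> s) l sequentially}"

lemma limitin_weak_star:
  assumes "\<And>n. sets (f n) = sets borel" "\<And>n. finite_measure (f n)"
  shows "limitin weak_star_topology f M sequentially \<longleftrightarrow>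
    sets M = sets borel \<and> finite_measure M \<and>
    (\<forall>\<phi>\<in>C\<^sub>0. (\<lambda>n. \<integral>x. \<phi> x \<partial>f n) \<longlonglongrightarrow> (\<integral>x. \<phi> x \<partial>M))"
proof -
  let ?I = "\<lambda>M. \<lambda>\<phi>\<in>C\<^sub>0. \<integral>x. \<phi> x \<partial>M"
  let ?A = "{M :: 'a measure. sets M = sets borel \<and> finite_measure M}"
  have "limitin weak_star_topology f M sequentially \<longleftrightarrow>
      M \<in> ?A \<and> limitin (powertop_real C\<^sub>0) (\<lambda>n. ?I (f n)) (?I M) sequentially"
  proof -
    have fA: "f n \<in> ?A" for n
      using assms by simp
    have *: "(\<forall>V. openin weak_star_topology V \<and> M \<in> V \<longrightarrow> (\<forall>\<^sub>F n in sequentially. f n \<in> V))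
      \<longleftrightarrow> (\<forall>U. openin (powertop_real C\<^sub>0) U \<and> ?I M \<in> U
            \<longrightarrow> (\<forall>\<^sub>F n in sequentially. ?I (f n) \<in> U))" (is "?L \<longleftrightarrow> ?R")
      if "M \<in> ?A"
    proof
      assume L: ?L
      show ?R
      proof (intro allI impI)
        fix U assume U: "openin (powertop_real C\<^sub>0) U \<and> ?I M \<in> U"
        have "openin weak_star_topology (?I -` U \<inter> ?A)"
          unfolding weak_star_topology_def openin_pullback_topology using U by blast
        then have "\<forall>\<^sub>F n in sequentially. f n \<in> ?I -` U \<inter> ?A"
          using L U that by blast
        then show "\<forall>\<^sub>F n in sequentially. ?I (f n) \<in> U"
          by (rule eventually_mono) simp
      qed
    next
      assume R: ?R
      show ?L
      proof (intro allI impI)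
        fix V assume V: "openin weak_star_topology V \<and> M \<in> V"
        then obtain U where U: "openin (powertop_real C\<^sub>0) U" "V = ?I -` U \<inter> ?A"
          unfolding weak_star_topology_def openin_pullback_topology by blast
        then have "\<forall>\<^sub>F n in sequentially. ?I (f n) \<in> U"
          using R V by simp
        then show "\<forall>\<^sub>F n in sequentially. f n \<in> V"
          by (rule eventually_mono) (use U fA in simp)
      qed
    qed
    have "topspace weak_star_topology = ?A"
      unfolding weak_star_topology_def topspace_pullback_topology by (auto simp: PiE_def)
    then show ?thesis
      unfolding limitin_def using * by (auto simp: PiE_def)
  qed
  also have "\<dots> \<longleftrightarrow> M \<in> ?A \<and> (\<forall>\<phi>\<in>C\<^sub>0. (\<lambda>n. \<integral>x. \<phi> x \<partial>f n) \<longlonglongrightarrow> (\<integral>x. \<phi> x \<partial>M))"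
    by (simp add: limitin_componentwise PiE_def)
  finally show ?thesis
    by simp
qed

end

theory Submission
  imports Defs
begin

text \<open>
  The radii of consecutive points of the spiral differ by about \<open>2 / i\<close>, while the angle moves only
  by \<open>1 / (i ln i)\<close>. So the step \<open>\<epsilon>\<^sub>i\<close> is asymptotic to \<open>2 / i\<close>, the velocity on the \<open>i\<close>-th piece
  is close to the radial unit vector with alternating sign, and the \<open>i\<close>-th knot is asymptotic to
  \<open>2 ln i\<close>. The angle is \<open>ln (ln i)\<close> up to a convergent term, by the integral test. Together, at
  time \<open>t\<close> the angle is \<open>ln t + C + o(1)\<close> for a constant \<open>C\<close> (\<open>angle_piece_tendsto\<close>), and along the
  curve a continuous function \<open>\<phi>\<close> is \<open>g(ln t + C)\<close> plus an alternating term plus \<open>o(1)\<close>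
  (\<open>tendsto_along_curve\<close>), where \<open>g(\<theta>)\<close> is the mean of \<open>\<phi>\<close> over the two phase points
  \<open>(r(\<theta>), \<plusminus> r(\<theta>))\<close>.

  The alternating term disappears in time averages, by summation by parts. For the main term let
  \<open>G(x)\<close> be the average of \<open>g\<close> over \<open>[x - 2\<pi>, x]\<close> with weight proportional to \<open>e\<^sup>\<theta>\<close>, that is, the
  integral of \<open>\<phi>\<close> against the limit measure with parameter \<open>x\<close>. As \<open>g\<close> is \<open>2\<pi>\<close>-periodic,
  \<open>G' = g - G\<close>, hence \<open>T G(ln T + C)\<close> is a primitive of \<open>g(ln T + C)\<close>: the average of the main term
  over \<open>[0, T]\<close> is exactly \<open>G(ln T + C)\<close>. This gives \<open>tendsto_curve_average\<close>: integrals against the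
  measure of \<open>[0, N]\<close> and against the limit measure with parameter \<open>ln N + C\<close> differ by \<open>o(1)\<close>.

  The parameter matters only modulo \<open>2\<pi>\<close>. A limit point therefore is a limit measure, by compactness of
  \<open>[0, 2\<pi>]\<close> and because functions vanishing at infinity determine a finite Borel measure. Conversely,
  since the increments of \<open>ln N\<close> tend to \<open>0\<close>, every parameter is approached modulo \<open>2\<pi>\<close> along a
  subsequence. Uncountability follows by evaluating the limit measures on a function for which
  \<open>g = cos\<close>: the values form a connected set with more than one point.
\<close>

section \<open>Averages over long intervals\<close>

lemma tendsto_average:
  fixes f :: "real \<Rightarrow> real"
  assumes int: "\<And>T. 0 \<le> T \<Longrightarrow> f integrable_on {0..T}"
    and lim: "(f \<longlongrightarrow> 0) at_top"
  shows "((\<lambda>T. integral {0..T} f / T) \<longlongrightarrow> 0) at_top"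
proof (rule tendstoI)
  fix e :: real assume "0 < e"
  then have "\<forall>\<^sub>F t in at_top. dist (f t) 0 < e / 2"
    using lim by (intro tendstoD) auto
  then obtain a where a: "\<And>t. a \<le> t \<Longrightarrow> \<bar>f t\<bar> < e / 2"
    by (auto simp: eventually_at_top_linorder)
  define b where "b = max a 0"
  define K where "K = \<bar>integral {0..b} f\<bar>"
  have b: "0 \<le> b" "\<And>t. b \<le> t \<Longrightarrow> \<bar>f t\<bar> \<le> e / 2"
    using a by (auto simp: b_def less_imp_le)
  show "\<forall>\<^sub>F T in at_top. dist (integral {0..T} f / T) 0 < e"
    using eventually_ge_at_top[of b] eventually_gt_at_top[of 0] eventually_gt_at_top[of "2 * K / e"]
  proof eventually_elim
    case (elim T)
    have fT: "f integrable_on {b..T}"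
      by (rule integrable_on_subinterval[OF int[of T]]) (use b elim in auto)
    have "norm (integral {b..T} f) \<le> e / 2 * (T - b)"
      using has_integral_bound_real[where S = "{}", OF _ _ fT[THEN integrable_integral], of "e / 2"]
        b elim \<open>0 < e\<close> by auto
    also have "\<dots> \<le> e / 2 * T"
      using b \<open>0 < e\<close> by (intro mult_left_mono) auto
    finally have "\<bar>integral {b..T} f\<bar> \<le> e / 2 * T"
      by simp
    moreover have "integral {0..T} f = integral {0..b} f + integral {b..T} f"
      using b elim int[of T] by (subst Henstock_Kurzweil_Integration.integral_combine) auto
    moreover have "K < e / 2 * T"
      using elim \<open>0 < e\<close> by (simp add: field_simps)
    ultimately have "\<bar>integral {0..T} f\<bar> < e * T"
      unfolding K_def by (simp add: field_simps)
    then show ?case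
      using elim by (simp add: dist_real_def divide_simps abs_div)
  qed
qed

lemma tendsto_diff_uniformly_continuous:
  fixes f :: "'a::metric_space \<Rightarrow> 'b::real_normed_vector"
  assumes "uniformly_continuous_on S f"
    and "\<forall>\<^sub>F t in G. p t \<in> S" "\<forall>\<^sub>F t in G. q t \<in> S"
    and "((\<lambda>t. dist (p t) (q t)) \<longlongrightarrow> 0) G"
  shows "((\<lambda>t. f (p t) - f (q t)) \<longlongrightarrow> 0) G"
proof (rule tendstoI)
  fix e :: real assume "0 < e"
  then obtain d where d: "0 < d" "\<And>u v. u \<in> S \<Longrightarrow> v \<in> S \<Longrightarrow> dist v u < d \<Longrightarrow> dist (f v) (f u) < e"
    using assms(1) unfolding uniformly_continuous_on_def by metis
  have "\<forall>\<^sub>F t in G. dist (dist (p t) (q t)) 0 < d"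
    using assms(4) \<open>0 < d\<close> by (rule tendstoD)
  with assms(2,3) show "\<forall>\<^sub>F t in G. dist (f (p t) - f (q t)) 0 < e"
    by eventually_elim (use d(2) in \<open>auto simp: dist_norm\<close>)
qed

section \<open>Curves interpolating a sequence\<close>

text \<open>Sequences for which the pieces partition \<open>[0, \<infinity>)\<close>.\<close>

locale interpolated_sequence =
  fixes x :: "nat \<Rightarrow> 'a::euclidean_space"
  assumes step_pos: "2 \<le> i \<Longrightarrow> 0 < step x i"
    and knot_at_top: "filterlim (knot x) at_top sequentially"
begin

text \<open>The constant velocity of the interpolating curve on the \<open>i\<close>-th piece, a unit vector for \<open>i \<ge> 2\<close>.\<close>

definition velocity :: "nat \<Rightarrow> 'a" where
  "velocity i = (1 / step x i) *\<^sub>R (x (Suc i) - x i)"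

lemma knot_2: "knot x 2 = 0"
  by (simp add: knot_def)

lemma knot_Suc: "2 \<le> i \<Longrightarrow> knot x (Suc i) = knot x i + step x i"
  by (simp add: knot_def)

lemma knot_mono: "m \<le> n \<Longrightarrow> knot x m \<le> knot x n"
  unfolding knot_def
  by (rule sum_mono2) (auto intro: less_imp_le[OF step_pos])

lemma knot_less_Suc: "2 \<le> i \<Longrightarrow> knot x i < knot x (Suc i)"
  by (simp add: knot_Suc step_pos)

lemma knot_nonneg: "0 \<le> knot x i"
  unfolding knot_def by (rule sum_nonneg) (auto intro: less_imp_le[OF step_pos])

lemma piece_eq:
  assumes "2 \<le> i" "knot x i \<le> t" "t < knot x (Suc i)"
  shows "piece x t = i"
  unfolding piece_def
proof (rule the_equality)
  fix j assume j: "2 \<le> j \<and> knot x j \<le> t \<and> t < knot x (Suc j)"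
  show "j = i"
    using knot_mono[of "Suc i" j] knot_mono[of "Suc j" i] assms j
    by (cases i j rule: linorder_cases) auto
qed (use assms in auto)

lemma piece_bounds:
  assumes "0 \<le> t"
  shows "2 \<le> piece x t" "knot x (piece x t) \<le> t" "t < knot x (Suc (piece x t))"
proof -
  have ex: "\<exists>n. t < knot x n"
    using knot_at_top by (auto simp: filterlim_at_top_dense eventually_sequentially)
  define n where "n = (LEAST n. t < knot x n)"
  have n: "t < knot x n"
    unfolding n_def using ex by (rule LeastI_ex)
  have "2 < n"
    using n assms knot_mono[of n 2] knot_2 by (cases "n \<le> 2") auto
  moreover have "knot x (n - 1) \<le> t"
    using not_less_Least[of "n - 1" "\<lambda>n. t < knot x n"] \<open>2 < n\<close> by (simp add: n_def not_less)
  ultimately have "piece x t = n - 1"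
    using n by (intro piece_eq) auto
  then show "2 \<le> piece x t" "knot x (piece x t) \<le> t" "t < knot x (Suc (piece x t))"
    using \<open>2 < n\<close> \<open>knot x (n - 1) \<le> t\<close> n by auto
qed

lemma piece_eq_iff:
  assumes "0 \<le> t"
  shows "piece x t = i \<longleftrightarrow> 2 \<le> i \<and> knot x i \<le> t \<and> t < knot x (Suc i)"
  using piece_bounds[OF assms] piece_eq by blast

text \<open>To the left of \<open>0\<close> no piece qualifies, so the description operator returns one fixed
  unspecified index; the curve is still affine there, and no case distinction is needed below.\<close>

lemma piece_neg: "t < 0 \<Longrightarrow> piece x t = (THE i. False)"
proof -
  assume "t < 0"
  then have "\<not> (2 \<le> i \<and> knot x i \<le> t \<and> t < knot x (Suc i))" for i
    using knot_nonneg[of i] by auto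
  then show ?thesis
    unfolding piece_def by (simp only:)
qed

lemma piece_at_top: "filterlim (piece x) at_top at_top"
  unfolding filterlim_at_top
proof
  fix n
  show "\<forall>\<^sub>F t in at_top. n \<le> piece x t"
    using eventually_ge_at_top[of "max 0 (knot x n)"]
  proof eventually_elim
    case (elim t)
    show ?case
    proof (rule ccontr)
      assume "\<not> n \<le> piece x t"
      then have "knot x (Suc (piece x t)) \<le> knot x n"
        by (intro knot_mono) auto
      with piece_bounds(3)[of t] elim show False
        by auto
    qed
  qed
qed

lemma measurable_piece [measurable]: "piece x \<in> borel \<rightarrow>\<^sub>M count_space UNIV"
proof -
  have "piece x -` {i} =
      (if 2 \<le> i then {knot x i..<knot x (Suc i)} \<inter> {0..} else {}) \<union>
      (if i = (THE i. False) then {..<0} else {})" for i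
    using piece_neg piece_eq_iff by (auto simp: not_le not_less) (metis not_le)+
  then show ?thesis
    by (subst measurable_count_space_eq2_countable) auto
qed

lemma borel_measurable_piece_comp [measurable]:
  fixes f :: "nat \<Rightarrow> 'b::topological_space"
  shows "(\<lambda>t. f (piece x t)) \<in> borel_measurable borel"
  by (rule measurable_compose[OF measurable_piece]) simp

lemma borel_measurable_interp_curve [measurable]: "interp_curve x \<in> borel_measurable borel"
  unfolding interp_curve_def Let_def by measurable

lemma vector_derivative_interp_curve:
  assumes "t \<notin> knot x ` {2..}"
  shows "vector_derivative (interp_curve x) (at t) = velocity (piece x t)"
proof -
  obtain U where U: "open U" "t \<in> U" "\<And>s. s \<in> U \<Longrightarrow> piece x s = piece x t"
  proof (cases "t < 0")
    case True
    then show ?thesis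
      using that[of "{..<0}"] by (simp add: piece_neg)
  next
    case False
    then have *: "2 \<le> piece x t" "knot x (piece x t) \<le> t" "t < knot x (Suc (piece x t))"
      using piece_bounds[of t] by simp_all
    moreover have "knot x (piece x t) \<noteq> t"
      using assms *(1) by (metis atLeast_iff imageI)
    ultimately have "2 \<le> piece x t" "knot x (piece x t) < t" "t < knot x (Suc (piece x t))"
      by simp_all
    then show ?thesis
      by (intro that[of "{knot x (piece x t)<..<knot x (Suc (piece x t))}"] piece_eq) auto
  qed
  let ?i = "piece x t"
  have "((\<lambda>s. x ?i + ((s - knot x ?i) / step x ?i) *\<^sub>R (x (Suc ?i) - x ?i))
      has_vector_derivative velocity ?i) (at t)"
    unfolding velocity_def divide_inverse by (auto intro!: derivative_eq_intros)
  then have "(interp_curve x has_vector_derivative velocity ?i) (at t)"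
    by (rule has_vector_derivative_transform_within_open[OF _ U(1,2)])
       (simp add: interp_curve_def U(3) Let_def)
  then show ?thesis
    by (rule vector_derivative_at)
qed

lemma borel_measurable_vector_derivative_interp_curve [measurable]:
  "(\<lambda>t. vector_derivative (interp_curve x) (at t)) \<in> borel_measurable borel"
  by (rule measurable_discrete_difference[where X = "knot x ` {2..}" and f = "\<lambda>t. velocity (piece x t)"])
     (auto simp: vector_derivative_interp_curve)

lemma sets_curve_measure: "sets (curve_measure (interp_curve x) B) = sets borel"
  by (simp add: curve_measure_def)

lemma prob_space_curve_measure:
  assumes "0 < T"
  shows "prob_space (curve_measure (interp_curve x) {0..T})"
  unfolding curve_measure_def
  by (intro prob_space.prob_space_distr prob_space_uniform_measure)
     (use assms in \<open>auto simp: borel_prod[symmetric]\<close>)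

lemma integral_curve_measure:
  fixes \<phi> :: "'a \<times> 'a \<Rightarrow> real"
  assumes [measurable]: "\<phi> \<in> borel_measurable borel" and B: "\<And>z. \<bar>\<phi> z\<bar> \<le> B" and "0 < T"
  defines "F \<equiv> \<lambda>t. \<phi> (interp_curve x t, velocity (piece x t))"
  shows "F integrable_on {0..T}"
    and "(\<integral>z. \<phi> z \<partial>curve_measure (interp_curve x) {0..T}) = integral {0..T} F / T"
proof -
  have "(\<lambda>t. (interp_curve x t, velocity (piece x t))) \<in> borel \<rightarrow>\<^sub>M borel"
    unfolding borel_prod[symmetric] by measurable
  from measurable_compose[OF this assms(1)]
  have [measurable]: "F \<in> borel_measurable borel"
    by (simp add: F_def)
  have int: "set_integrable lborel {0..T} F"
    unfolding set_integrable_def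
    by (rule integrableI_bounded_set_indicator[where B = B])
       (use B \<open>0 < T\<close> in \<open>auto simp: F_def\<close>)
  show "F integrable_on {0..T}"
    using set_borel_integral_eq_integral(1)[OF int] .
  have mF [measurable]: "(\<lambda>t. (interp_curve x t, vector_derivative (interp_curve x) (at t))) \<in> borel \<rightarrow>\<^sub>M borel"
    unfolding borel_prod[symmetric] by measurable
  have "(\<integral>z. \<phi> z \<partial>curve_measure (interp_curve x) {0..T}) =
      (\<integral>t. \<phi> (interp_curve x t, vector_derivative (interp_curve x) (at t)) \<partial>uniform_measure lborel {0..T})"
    unfolding curve_measure_def
    by (rule integral_distr) auto
  also have "uniform_measure lborel {0..T} = density lborel (\<lambda>t. ennreal (indicator {0..T} t / T))"
    unfolding uniform_measure_def using \<open>0 < T\<close>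
    by (intro arg_cong[where f = "density _"] ext)
       (auto simp: divide_ennreal[symmetric] ennreal_indicator[symmetric])
  also have "(\<integral>t. \<phi> (interp_curve x t, vector_derivative (interp_curve x) (at t)) \<partial>\<dots>) =
      (\<integral>t. indicator {0..T} t / T * \<phi> (interp_curve x t, vector_derivative (interp_curve x) (at t)) \<partial>lborel)"
    by (subst integral_density) (use \<open>0 < T\<close> in \<open>auto\<close>)
  also have "\<dots> = (\<integral>t. (indicator {0..T} t * F t) / T \<partial>lborel)"
  proof (rule integral_cong_AE)
    have "AE t in lborel. t \<notin> knot x ` {2..}"
      by (rule AE_not_in) (auto intro!: countable_imp_null_set_lborel)
    then show "AE t in lborel. indicator {0..T} t / T *
          \<phi> (interp_curve x t, vector_derivative (interp_curve x) (at t)) = indicator {0..T} t * F t / T"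
      by eventually_elim (simp add: F_def vector_derivative_interp_curve)
    show "(\<lambda>t. (indicator {0..T} t * F t) / T) \<in> borel_measurable lborel"
      using int unfolding set_integrable_def by auto
  qed (use mF in measurable)
  also have "\<dots> = integral {0..T} F / T"
    using set_borel_integral_eq_integral(2)[OF int] by (simp add: set_lebesgue_integral_def)
  finally show "(\<integral>z. \<phi> z \<partial>curve_measure (interp_curve x) {0..T}) = integral {0..T} F / T" .
qed

lemma has_integral_piece:
  fixes f :: "nat \<Rightarrow> real"
  assumes "2 \<le> n" "knot x n \<le> T" "T \<le> knot x (Suc n)"
  shows "((\<lambda>t. f (piece x t)) has_integral (T - knot x n) * f n) {knot x n..T}"
proof (rule has_integral_spike_finite[where S = "{knot x (Suc n)}"])
  show "((\<lambda>t. f n) has_integral (T - knot x n) * f n) {knot x n..T}"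
    using has_integral_const_real[of "f n" "knot x n" T] assms by simp
qed (use assms in \<open>auto simp: piece_eq\<close>)

lemma has_integral_telescope:
  fixes Q :: "nat \<Rightarrow> real"
  assumes "2 \<le> n"
  shows "((\<lambda>t. (Q (Suc (piece x t)) - Q (piece x t)) / step x (piece x t)) has_integral (Q n - Q 2))
           {0..knot x n}"
  using assms
proof (induction n rule: dec_induct)
  case base
  then show ?case by (simp add: knot_2 has_integral_refl)
next
  case (step n)
  have "((\<lambda>t. (Q (Suc (piece x t)) - Q (piece x t)) / step x (piece x t)) has_integral
      (knot x (Suc n) - knot x n) * ((Q (Suc n) - Q n) / step x n)) {knot x n..knot x (Suc n)}"
    by (rule has_integral_piece[where f = "\<lambda>i. (Q (Suc i) - Q i) / step x i"]) 
       (use step knot_less_Suc[of n] in auto)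
  then have "((\<lambda>t. (Q (Suc (piece x t)) - Q (piece x t)) / step x (piece x t)) has_integral
      (Q (Suc n) - Q n)) {knot x n..knot x (Suc n)}"
    using step step_pos[of n] by (simp add: knot_Suc)
  from has_integral_combine[OF knot_nonneg _ step.IH this] show ?case
    using step knot_less_Suc[of n] by simp
qed

lemma integrable_telescope:
  fixes Q :: "nat \<Rightarrow> real"
  assumes "0 \<le> T"
  shows "(\<lambda>t. (Q (Suc (piece x t)) - Q (piece x t)) / step x (piece x t)) integrable_on {0..T}"
proof (rule integrable_on_subinterval[OF has_integral_integrable[OF has_integral_telescope]])
  show "{0..T} \<subseteq> {0..knot x (Suc (piece x T))}" "2 \<le> Suc (piece x T)"
    using piece_bounds[OF assms] by auto
qed

text \<open>A piecewise constant function that telescopes over the pieces: its primitive interpolates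
  the bounded sequence \<open>Q\<close> up to a constant, so its integrals over \<open>[0, T]\<close> stay bounded.\<close>

lemma integral_telescope_bounded:
  fixes Q :: "nat \<Rightarrow> real"
  assumes Q: "\<And>i. 2 \<le> i \<Longrightarrow> \<bar>Q i\<bar> \<le> B" and "0 \<le> T"
  shows "\<bar>integral {0..T} (\<lambda>t. (Q (Suc (piece x t)) - Q (piece x t)) / step x (piece x t))\<bar> \<le> 4 * B"
proof -
  define \<tau> where "\<tau> = (\<lambda>t. (Q (Suc (piece x t)) - Q (piece x t)) / step x (piece x t))"
  define n where "n = piece x T"
  have n: "2 \<le> n" "knot x n \<le> T" "T < knot x (Suc n)"
    using piece_bounds[OF \<open>0 \<le> T\<close>] by (auto simp: n_def)
  let ?r = "(T - knot x n) / step x n"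
  have "(\<tau> has_integral (T - knot x n) * ((Q (Suc n) - Q n) / step x n)) {knot x n..T}"
    unfolding \<tau>_def
    by (rule has_integral_piece[where f = "\<lambda>i. (Q (Suc i) - Q i) / step x i"]) (use n in auto)
  from has_integral_combine[OF knot_nonneg n(2) has_integral_telescope[OF n(1), of Q, folded \<tau>_def] this]
  have *: "(\<tau> has_integral (Q n - Q 2) + ?r * (Q (Suc n) - Q n)) {0..T}"
    by simp
  have "0 \<le> ?r" "?r \<le> 1"
    using n step_pos[of n] by (auto simp: knot_Suc divide_simps)
  then have "\<bar>?r * (Q (Suc n) - Q n)\<bar> \<le> \<bar>Q (Suc n) - Q n\<bar>"
    unfolding abs_mult by (intro mult_left_le_one_le) auto
  then show ?thesis
    unfolding \<tau>_def[symmetric]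
    using integral_unique[OF *] Q[of n] Q[of 2] Q[of "Suc n"] n unfolding abs_le_iff by linarith
qed

text \<open>The Stolz--Cesaro theorem for quotients by the knots.\<close>

lemma tendsto_div_knot:
  fixes Q :: "nat \<Rightarrow> real"
  assumes "(\<lambda>i. (Q (Suc i) - Q i) / step x i) \<longlonglongrightarrow> 0"
  shows "(\<lambda>n. Q n / knot x n) \<longlonglongrightarrow> 0"
proof -
  let ?\<tau> = "\<lambda>t. (Q (Suc (piece x t)) - Q (piece x t)) / step x (piece x t)"
  have "((\<lambda>T. integral {0..T} ?\<tau> / T) \<longlongrightarrow> 0) at_top"
    by (rule tendsto_average[OF integrable_telescope filterlim_compose[OF assms piece_at_top]])
  from filterlim_compose[OF this knot_at_top]
  have "(\<lambda>n. integral {0..knot x n} ?\<tau> / knot x n) \<longlonglongrightarrow> 0" .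
  moreover have "\<forall>\<^sub>F n in sequentially. integral {0..knot x n} ?\<tau> / knot x n = (Q n - Q 2) / knot x n"
    using eventually_ge_at_top[of 2]
    by eventually_elim (simp add: integral_unique[OF has_integral_telescope])
  ultimately have "(\<lambda>n. (Q n - Q 2) / knot x n) \<longlonglongrightarrow> 0"
    using tendsto_cong by fast
  moreover have "(\<lambda>n. Q 2 / knot x n) \<longlonglongrightarrow> 0"
    by (rule tendsto_divide_0[OF tendsto_const filterlim_at_top_imp_at_infinity[OF knot_at_top]])
  ultimately have "(\<lambda>n. (Q n - Q 2) / knot x n + Q 2 / knot x n) \<longlonglongrightarrow> 0 + 0"
    by (rule tendsto_add)
  then show ?thesis
    by (simp add: diff_divide_distrib)
qed

end

section \<open>Finite Borel measures as functionals\<close>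

lemma C\<^sub>0_bounded:
  assumes "\<phi> \<in> C\<^sub>0"
  obtains B where "\<And>z. \<bar>\<phi> z\<bar> \<le> B"
proof -
  have cont: "continuous_on UNIV \<phi>" and lim: "(\<phi> \<longlongrightarrow> 0) at_infinity"
    using assms by (auto simp: C\<^sub>0_def)
  have "\<forall>\<^sub>F z in at_infinity. dist (\<phi> z) 0 < 1"
    using lim by (rule tendstoD) simp
  then obtain R where R: "\<And>z. R \<le> norm z \<Longrightarrow> \<bar>\<phi> z\<bar> < 1"
    by (auto simp: eventually_at_infinity)
  have "compact (\<phi> ` cball 0 R)"
    by (rule compact_continuous_image[OF continuous_on_subset[OF cont]]) auto
  then obtain K where "\<And>z. z \<in> cball 0 R \<Longrightarrow> \<bar>\<phi> z\<bar> \<le> K"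
    by (force simp: bounded_iff dest!: compact_imp_bounded)
  then have "\<bar>\<phi> z\<bar> \<le> max K 1" for z
    using R[of z] by (cases "norm z \<le> R") (auto simp: le_max_iff_disj)
  then show thesis
    by (rule that)
qed

text \<open>On a bounded open box the functions \<open>min 1 (n * infdist z (- U))\<close>, which have compact
  support, increase to the indicator; boxes generate the Borel sets.\<close>

lemma finite_measure_eqI_C\<^sub>0:
  fixes M N :: "'a::euclidean_space measure"
  assumes M: "sets M = sets borel" "finite_measure M"
    and N: "sets N = sets borel" "finite_measure N"
    and eq: "\<And>\<phi>. \<phi> \<in> C\<^sub>0 \<Longrightarrow> (\<integral>z. \<phi> z \<partial>M) = (\<integral>z. \<phi> z \<partial>N)"
  shows "M = N"
proof (rule measure_eqI_generator_eq[where \<Omega> = UNIV and E = "range (\<lambda>(a, b). box a b)"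
      and A = "\<lambda>n. box (- (real n *\<^sub>R One)) (real n *\<^sub>R One)"])
  interpret M: finite_measure M by fact
  interpret N: finite_measure N by fact
  note [measurable_cong] = M(1) N(1)
  show "Int_stable (range (\<lambda>(a, b). box a b :: 'a set))"
    by (auto simp: Int_stable_def Int_interval box_Int_box)
  show "sets M = sigma_sets UNIV (range (\<lambda>(a, b). box a b))"
    "sets N = sigma_sets UNIV (range (\<lambda>(a, b). box a b))"
    unfolding M N by (subst borel_eq_box, simp)+
  show "emeasure M X = emeasure N X" if X: "X \<in> range (\<lambda>(a, b). box a b)" for X
  proof -
    have X: "open X" "bounded X"
      using X by auto
    then have "- X \<noteq> {}"
      using not_bounded_UNIV[where 'a = 'a] double_complement[of X] by (metis Compl_empty_eq)
    define f where "f = (\<lambda>n z. min 1 (real n * infdist z (- X)))"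
    have f_cont: "continuous_on UNIV (f n)" for n
      unfolding f_def by (intro continuous_intros)
    have f_0: "f n z = 0" if "z \<notin> X" for n z
      using that by (simp add: f_def)
    have [measurable]: "f n \<in> borel_measurable borel" for n
      using f_cont by (rule borel_measurable_continuous_onI)
    have [measurable]: "X \<in> sets borel"
      using X by simp
    have f_le: "norm (f n z) \<le> 1" for n z
      using infdist_nonneg[of z "- X"] by (auto simp: f_def)
    have f_lim: "(\<lambda>n. f n z) \<longlonglongrightarrow> indicator X z" for z
    proof (cases "z \<in> X")
      case True
      then have "infdist z (- X) > 0"
        using in_closed_iff_infdist_zero[of "- X" z] X \<open>- X \<noteq> {}\<close> infdist_nonneg[of z "- X"]
        by (auto simp: less_le closed_def)
      then have "filterlim (\<lambda>n. real n * infdist z (- X)) at_top sequentially"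
        by (intro filterlim_at_top_mult_tendsto_pos[OF tendsto_const] filterlim_real_sequentially) auto
      then have "\<forall>\<^sub>F n in sequentially. 1 \<le> real n * infdist z (- X)"
        by (simp add: filterlim_at_top)
      then have "\<forall>\<^sub>F n in sequentially. f n z = indicator X z"
        by eventually_elim (simp add: f_def True)
      then show ?thesis
        by (rule tendsto_eventually)
    qed (simp add: f_0)
    have f_C\<^sub>0: "f n \<in> C\<^sub>0" for n
    proof -
      obtain R where R: "\<And>z. z \<in> X \<Longrightarrow> norm z \<le> R"
        using X by (auto simp: bounded_iff)
      have "\<forall>\<^sub>F z in at_infinity. f n z = 0"
        unfolding eventually_at_infinity
        by (rule exI[of _ "R + 1"]) (use R f_0 in force)
      then show ?thesis
        by (auto simp: C\<^sub>0_def f_cont intro: tendsto_eventually)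
    qed
    have "(\<lambda>n. \<integral>z. f n z \<partial>M) \<longlonglongrightarrow> (\<integral>z. indicator X z \<partial>M)"
      by (rule integral_dominated_convergence[where w = "\<lambda>_. 1"]) (use f_lim f_le in auto)
    moreover have "(\<lambda>n. \<integral>z. f n z \<partial>N) \<longlonglongrightarrow> (\<integral>z. indicator X z \<partial>N)"
      by (rule integral_dominated_convergence[where w = "\<lambda>_. 1"]) (use f_lim f_le in auto)
    ultimately have "(\<integral>z. indicator X z \<partial>M) = (\<integral>z. indicator X z \<partial>N :: real)"
      using eq[OF f_C\<^sub>0] LIMSEQ_unique by auto
    then have "measure M X = measure N X"
      by (simp add: sets_eq_imp_space_eq[OF M(1)] sets_eq_imp_space_eq[OF N(1)])
    then show ?thesis
      by (simp add: M.emeasure_eq_measure N.emeasure_eq_measure)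
  qed
  show "(\<Union>n. box (- (real n *\<^sub>R One)) (real n *\<^sub>R One)) = (UNIV :: 'a set)"
    by (rule UN_box_eq_UNIV)
  show "emeasure M (box (- (real n *\<^sub>R One)) (real n *\<^sub>R One)) \<noteq> \<infinity>" for n
    by simp
qed auto

section \<open>The limit measures\<close>

text \<open>The average of \<open>\<phi>\<close> over the two phase points above the angle \<open>\<theta>\<close>: position \<open>unit_vec \<theta>\<close>
  and velocity \<open>\<plusminus> unit_vec \<theta>\<close>, with weight one half each.\<close>

definition phase_average :: "((real ^ 2) \<times> (real ^ 2) \<Rightarrow> real) \<Rightarrow> real \<Rightarrow> real" where
  "phase_average \<phi> \<theta> = (\<phi> (unit_vec \<theta>, unit_vec \<theta>) + \<phi> (unit_vec \<theta>, - unit_vec \<theta>)) / 2"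

text \<open>The density at \<open>\<theta>\<close> of the exponential probability distribution on the period ending at \<open>x\<close>.\<close>

definition exp_weight :: "real \<Rightarrow> real \<Rightarrow> real" where
  "exp_weight x \<theta> = exp (\<theta> - x) / (1 - exp (- 2 * pi))"

text \<open>The average of \<open>g\<close> over the period ending at \<open>x\<close> with this density.\<close>

definition exp_average :: "(real \<Rightarrow> real) \<Rightarrow> real \<Rightarrow> real" where
  "exp_average g x = integral {x - 2 * pi..x} (\<lambda>\<theta>. g \<theta> * exp_weight x \<theta>)"

lemma exp_2pi_less_1: "exp (- 2 * pi) < 1"
  using pi_gt_zero by simp

lemma exp_weight_nonneg: "0 \<le> exp_weight x \<theta>"
  using exp_2pi_less_1 by (simp add: exp_weight_def)

lemma exp_weight_le: "\<theta> \<le> x \<Longrightarrow> exp_weight x \<theta> \<le> exp_weight 0 0"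
  unfolding exp_weight_def using exp_2pi_less_1 by (intro divide_right_mono) auto

lemma continuous_on_exp_weight [continuous_intros]: "continuous_on A (exp_weight x)"
  unfolding exp_weight_def using exp_2pi_less_1 by (intro continuous_intros) auto

lemma borel_measurable_exp_weight [measurable]: "exp_weight x \<in> borel_measurable borel"
  by (intro borel_measurable_continuous_onI continuous_on_exp_weight)

lemma abs_mult_exp_weight_le:
  assumes "\<bar>c\<bar> \<le> B" "\<theta> \<le> x"
  shows "\<bar>c * exp_weight x \<theta>\<bar> \<le> B * exp_weight 0 0"
  unfolding abs_mult using assms exp_weight_le[of \<theta> x] exp_weight_nonneg[of x \<theta>]
  by (intro mult_mono) auto

lemma nn_integral_limit_measure:
  assumes f: "f \<in> borel_measurable borel"
  shows "(\<integral>\<^sup>+z. f z \<partial>limit_measure \<theta>\<^sub>0) =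
    (\<integral>\<^sup>+\<theta>\<in>{\<theta>\<^sub>0 - 2 * pi..\<theta>\<^sub>0}. (f (unit_vec \<theta>, unit_vec \<theta>) + f (unit_vec \<theta>, - unit_vec \<theta>)) / 2
        * ennreal (exp_weight \<theta>\<^sub>0 \<theta>) \<partial>lborel)"
proof -
  have [measurable]: "(\<lambda>\<theta>. (unit_vec \<theta>, unit_vec \<theta>)) \<in> borel \<rightarrow>\<^sub>M borel"
    "(\<lambda>\<theta>. (unit_vec \<theta>, - unit_vec \<theta>)) \<in> borel \<rightarrow>\<^sub>M borel"
    unfolding borel_prod[symmetric] by measurable
  let ?w = "\<lambda>\<theta>. ennreal (exp_weight \<theta>\<^sub>0 \<theta>)"
  let ?k = "\<lambda>f \<theta>. (f (unit_vec \<theta>, unit_vec \<theta>) + f (unit_vec \<theta>, - unit_vec \<theta>)) / 2 * ?w \<theta>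
      * indicator {\<theta>\<^sub>0 - 2 * pi..\<theta>\<^sub>0} \<theta>"
  have meas: "?k f \<in> borel_measurable lborel" if "f \<in> borel_measurable borel" for f
  proof -
    have [measurable]: "(\<lambda>\<theta>. f (unit_vec \<theta>, unit_vec \<theta>)) \<in> borel_measurable borel"
      "(\<lambda>\<theta>. f (unit_vec \<theta>, - unit_vec \<theta>)) \<in> borel_measurable borel"
      by (rule measurable_compose[OF _ that], measurable)+
    show ?thesis
      by simp
  qed
  note [measurable_cong] = sets_limit_measure
  from f show ?thesis
  proof (induction rule: borel_measurable_induct)
    case (cong f g)
    then have "f = g" by auto
    with cong show ?case by simp
  next
    case (set A)
    then show ?case
      by (simp add: emeasure_limit_measure emeasure_return exp_weight_def)
  next
    case (mult f c)
    have "(\<integral>\<^sup>+\<theta>. ?k (\<lambda>z. c * f z) \<theta> \<partial>lborel) = (\<integral>\<^sup>+\<theta>. c * ?k f \<theta> \<partial>lborel)"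
      by (simp add: algebra_simps divide_ennreal_def)
    also have "\<dots> = c * (\<integral>\<^sup>+\<theta>. ?k f \<theta> \<partial>lborel)"
      using mult by (intro nn_integral_cmult meas)
    finally show ?case
      using mult by (simp add: nn_integral_cmult)
  next
    case (add f g)
    have "(\<integral>\<^sup>+\<theta>. ?k (\<lambda>z. g z + f z) \<theta> \<partial>lborel) = (\<integral>\<^sup>+\<theta>. ?k g \<theta> + ?k f \<theta> \<partial>lborel)"
      by (simp add: algebra_simps divide_ennreal_def)
    also have "\<dots> = (\<integral>\<^sup>+\<theta>. ?k g \<theta> \<partial>lborel) + (\<integral>\<^sup>+\<theta>. ?k f \<theta> \<partial>lborel)"
      using add by (intro nn_integral_add meas)
    finally show ?case
      using add by (simp add: nn_integral_add)
  next
    case (seq U)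
    have "(\<integral>\<^sup>+z. (SUP i. U i) z \<partial>limit_measure \<theta>\<^sub>0) = (\<integral>\<^sup>+z. (SUP i. U i z) \<partial>limit_measure \<theta>\<^sub>0)"
      by (simp add: image_comp)
    also have "\<dots> = (SUP i. \<integral>\<^sup>+z. U i z \<partial>limit_measure \<theta>\<^sub>0)"
      using seq by (intro nn_integral_monotone_convergence_SUP) auto
    also have "\<dots> = (SUP i. \<integral>\<^sup>+\<theta>. ?k (U i) \<theta> \<partial>lborel)"
      by (simp add: seq.IH)
    also have "\<dots> = (\<integral>\<^sup>+\<theta>. (SUP i. ?k (U i) \<theta>) \<partial>lborel)"
    proof (rule nn_integral_monotone_convergence_SUP[symmetric])
      show "incseq (\<lambda>i. ?k (U i))"
        using \<open>incseq U\<close> unfolding incseq_def le_fun_def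
        by (auto intro!: mult_right_mono divide_right_mono_ennreal add_mono)
    qed (use seq meas in auto)
    also have "\<dots> = (\<integral>\<^sup>+\<theta>. ?k (SUP i. U i) \<theta> \<partial>lborel)"
    proof (rule nn_integral_cong)
      fix \<theta>
      have inc: "incseq (\<lambda>i. U i z)" for z
        using \<open>incseq U\<close> unfolding incseq_def le_fun_def by blast
      show "(SUP i. ?k (U i) \<theta>) = ?k (SUP i. U i) \<theta>"
        by (simp add: SUP_mult_right_ennreal[symmetric] SUP_divide_ennreal[symmetric]
            ennreal_SUP_add inc image_comp SUP_mult_left_ennreal[symmetric])
    qed
    finally show ?case .
  qed
qed

lemma norm_unit_vec [simp]: "norm (unit_vec \<theta>) = 1"
  by (simp add: unit_vec_def norm_vec_def L2_set_def sum_2)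

lemma norm_unit_vec_diff: "norm (unit_vec a - unit_vec b) \<le> \<bar>a - b\<bar>"
proof -
  have "(norm (unit_vec a - unit_vec b))\<^sup>2 = (cos a - cos b)\<^sup>2 + (sin a - sin b)\<^sup>2"
    by (simp add: unit_vec_def norm_vec_def L2_set_def sum_2)
  also have "\<dots> = 2 - 2 * cos (a - b)"
    using sin_cos_squared_add[of a] sin_cos_squared_add[of b]
    unfolding cos_diff power2_eq_square by (simp add: algebra_simps)
  also have "\<dots> = (2 * sin ((a - b) / 2))\<^sup>2"
    using cos_double_sin[of "(a - b) / 2"] by (simp add: power_mult_distrib diff_divide_distrib)
  also have "\<dots> \<le> \<bar>a - b\<bar>\<^sup>2"
    using abs_sin_x_le_abs_x[of "(a - b) / 2"] by (intro power2_le_iff_abs_le[THEN iffD2]) auto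
  finally show ?thesis
    by (rule power2_le_imp_le) simp
qed

lemma continuous_on_unit_vec: "continuous_on A unit_vec"
proof (rule continuous_on_subset[OF _ subset_UNIV])
  have "lipschitz_on 1 UNIV unit_vec"
    by (rule lipschitz_onI) (auto simp: dist_norm norm_unit_vec_diff)
  then show "continuous_on UNIV unit_vec"
    by (rule lipschitz_on_continuous_on)
qed

lemma unit_vec_periodic: "unit_vec (\<theta> + 2 * pi) = unit_vec \<theta>"
  by (simp add: unit_vec_def)

lemma phase_average_periodic: "phase_average \<phi> (\<theta> + 2 * pi) = phase_average \<phi> \<theta>"
  by (simp add: phase_average_def unit_vec_periodic)

lemma continuous_phase_average:
  assumes "continuous_on UNIV \<phi>"
  shows "continuous_on UNIV (phase_average \<phi>)"
  unfolding phase_average_def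
  by (intro continuous_intros continuous_on_compose2[OF assms] continuous_on_unit_vec) auto

lemma abs_phase_average_le:
  assumes "\<And>z. \<bar>\<phi> z\<bar> \<le> B"
  shows "\<bar>phase_average \<phi> \<theta>\<bar> \<le> B"
proof -
  have "\<bar>(a + b) / 2\<bar> \<le> B" if "\<bar>a\<bar> \<le> B" "\<bar>b\<bar> \<le> B" for a b :: real
    using that by (simp add: abs_le_iff field_simps)
  then show ?thesis
    unfolding phase_average_def using assms by blast
qed

lemma set_integrable_exp_average:
  assumes [measurable]: "g \<in> borel_measurable borel" and B: "\<And>\<theta>. \<bar>g \<theta>\<bar> \<le> B"
  shows "set_integrable lborel {x - 2 * pi..x} (\<lambda>\<theta>. g \<theta> * exp_weight x \<theta>)"
  unfolding set_integrable_def
  by (rule integrableI_bounded_set_indicator[where B = "B * exp_weight 0 0"])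
     (auto intro!: AE_I2 abs_mult_exp_weight_le B simp: real_norm_def simp del: abs_mult)

lemma integral_limit_measure_nonneg:
  assumes [measurable]: "\<phi> \<in> borel_measurable borel" and B: "\<And>z. 0 \<le> \<phi> z" "\<And>z. \<phi> z \<le> B"
  shows "has_bochner_integral (limit_measure \<theta>\<^sub>0) \<phi> (exp_average (phase_average \<phi>) \<theta>\<^sub>0)"
proof -
  let ?S = "{\<theta>\<^sub>0 - 2 * pi..\<theta>\<^sub>0}"
  note [measurable_cong] = sets_limit_measure
  have [measurable]: "(\<lambda>\<theta>. (unit_vec \<theta>, unit_vec \<theta>)) \<in> borel \<rightarrow>\<^sub>M borel"
    "(\<lambda>\<theta>. (unit_vec \<theta>, - unit_vec \<theta>)) \<in> borel \<rightarrow>\<^sub>M borel"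
    unfolding borel_prod[symmetric] by measurable
  have [measurable]: "(\<lambda>\<theta>. \<phi> (unit_vec \<theta>, unit_vec \<theta>)) \<in> borel_measurable borel"
    "(\<lambda>\<theta>. \<phi> (unit_vec \<theta>, - unit_vec \<theta>)) \<in> borel_measurable borel"
    by (rule measurable_compose[OF _ assms(1)], measurable)+
  have [measurable]: "phase_average \<phi> \<in> borel_measurable borel"
    unfolding phase_average_def by measurable
  note w = exp_weight_nonneg[of \<theta>\<^sub>0]
  have g: "0 \<le> phase_average \<phi> \<theta>" for \<theta>
    unfolding phase_average_def using B by simp
  have int: "set_integrable lborel ?S (\<lambda>\<theta>. phase_average \<phi> \<theta> * exp_weight \<theta>\<^sub>0 \<theta>)"
    by (rule set_integrable_exp_average[where B = B]) (auto intro!: abs_phase_average_le simp: B)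
  have "(\<integral>\<^sup>+z. ennreal (\<phi> z) \<partial>limit_measure \<theta>\<^sub>0) =
      (\<integral>\<^sup>+\<theta>. ennreal (indicator ?S \<theta> *\<^sub>R (phase_average \<phi> \<theta> * exp_weight \<theta>\<^sub>0 \<theta>)) \<partial>lborel)"
  proof (subst nn_integral_limit_measure, measurable, rule nn_integral_cong)
    fix \<theta>
    have "(ennreal (\<phi> (unit_vec \<theta>, unit_vec \<theta>)) + ennreal (\<phi> (unit_vec \<theta>, - unit_vec \<theta>))) / 2 =
        ennreal (phase_average \<phi> \<theta>)"
      using B by (simp add: phase_average_def ennreal_plus[symmetric] divide_ennreal[symmetric] del: ennreal_plus)
    then show "(ennreal (\<phi> (unit_vec \<theta>, unit_vec \<theta>)) + ennreal (\<phi> (unit_vec \<theta>, - unit_vec \<theta>))) / 2 *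
        ennreal (exp_weight \<theta>\<^sub>0 \<theta>) * indicator ?S \<theta> = ennreal (indicator ?S \<theta> *\<^sub>R (phase_average \<phi> \<theta> * exp_weight \<theta>\<^sub>0 \<theta>))"
      by (auto simp: ennreal_mult[OF g w] split: split_indicator)
  qed
  also have "\<dots> = ennreal (\<integral>\<theta>. indicator ?S \<theta> *\<^sub>R (phase_average \<phi> \<theta> * exp_weight \<theta>\<^sub>0 \<theta>) \<partial>lborel)"
    using int w g unfolding set_integrable_def
    by (intro nn_integral_eq_integral) (auto intro!: AE_I2 mult_nonneg_nonneg )
  also have "(\<integral>\<theta>. indicator ?S \<theta> *\<^sub>R (phase_average \<phi> \<theta> * exp_weight \<theta>\<^sub>0 \<theta>) \<partial>lborel) =
      exp_average (phase_average \<phi>) \<theta>\<^sub>0"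
    using set_borel_integral_eq_integral(2)[OF int]
    by (simp add: set_lebesgue_integral_def exp_average_def)
  finally have eq: "(\<integral>\<^sup>+z. ennreal (\<phi> z) \<partial>limit_measure \<theta>\<^sub>0) = ennreal (exp_average (phase_average \<phi>) \<theta>\<^sub>0)" .
  show ?thesis
  proof (rule has_bochner_integral_nn_integral[OF _ _ _ eq])
    show "0 \<le> exp_average (phase_average \<phi>) \<theta>\<^sub>0"
      unfolding exp_average_def using set_borel_integral_eq_integral(1)[OF int]
      by (rule integral_nonneg) (intro mult_nonneg_nonneg g w)
  qed (use B in auto)
qed

lemma finite_measure_limit_measure: "finite_measure (limit_measure \<theta>\<^sub>0)"
proof (rule finite_measureI)
  have "has_bochner_integral (limit_measure \<theta>\<^sub>0) (\<lambda>_. 1 :: real)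
      (exp_average (phase_average (\<lambda>_. 1)) \<theta>\<^sub>0)"
    by (rule integral_limit_measure_nonneg[where B = 1]) auto
  then show "emeasure (limit_measure \<theta>\<^sub>0) (space (limit_measure \<theta>\<^sub>0)) \<noteq> \<infinity>"
    by (auto simp: has_bochner_integral_iff integrable_iff_bounded)
qed

text \<open>Adding the constant \<open>B\<close> reduces the signed case to the nonnegative one.\<close>

lemma integral_limit_measure:
  assumes [measurable]: "\<phi> \<in> borel_measurable borel" and B: "\<And>z. \<bar>\<phi> z\<bar> \<le> B"
  shows "(\<integral>z. \<phi> z \<partial>limit_measure \<theta>\<^sub>0) = exp_average (phase_average \<phi>) \<theta>\<^sub>0"
proof -
  let ?I = "integral {\<theta>\<^sub>0 - 2 * pi..\<theta>\<^sub>0}"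
  have "0 \<le> B"
    using B[of undefined] by linarith
  have bound: "0 \<le> \<phi> z + B" "\<phi> z + B \<le> 2 * B" for z
    using B[of z] by auto
  have "has_bochner_integral (limit_measure \<theta>\<^sub>0) (\<lambda>z. \<phi> z + B)
      (exp_average (phase_average (\<lambda>z. \<phi> z + B)) \<theta>\<^sub>0)"
    by (rule integral_limit_measure_nonneg[where B = "2 * B"]) (measurable, rule bound(1), rule bound(2))
  moreover have "has_bochner_integral (limit_measure \<theta>\<^sub>0) (\<lambda>z. B) (exp_average (phase_average (\<lambda>_. B)) \<theta>\<^sub>0)"
    by (rule integral_limit_measure_nonneg[where B = B]) (use \<open>0 \<le> B\<close> in auto)
  ultimately have "has_bochner_integral (limit_measure \<theta>\<^sub>0) (\<lambda>z. (\<phi> z + B) - B)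
      (exp_average (phase_average (\<lambda>z. \<phi> z + B)) \<theta>\<^sub>0 - exp_average (phase_average (\<lambda>_. B)) \<theta>\<^sub>0)"
    by (rule has_bochner_integral_diff)
  then have "(\<integral>z. \<phi> z \<partial>limit_measure \<theta>\<^sub>0) =
      exp_average (phase_average (\<lambda>z. \<phi> z + B)) \<theta>\<^sub>0 - exp_average (phase_average (\<lambda>_. B)) \<theta>\<^sub>0"
    by (simp add: has_bochner_integral_iff)
  also have "\<dots> = ?I (\<lambda>\<theta>. (phase_average \<phi> \<theta> + B) * exp_weight \<theta>\<^sub>0 \<theta>) - ?I (\<lambda>\<theta>. B * exp_weight \<theta>\<^sub>0 \<theta>)"
    by (simp add: exp_average_def phase_average_def add_divide_distrib add_ac)
  also have "\<dots> = ?I (\<lambda>\<theta>. (phase_average \<phi> \<theta> + B) * exp_weight \<theta>\<^sub>0 \<theta> - B * exp_weight \<theta>\<^sub>0 \<theta>)"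
  proof (rule integral_diff[symmetric])
    have [measurable]: "(\<lambda>\<theta>. (unit_vec \<theta>, unit_vec \<theta>)) \<in> borel \<rightarrow>\<^sub>M borel"
      "(\<lambda>\<theta>. (unit_vec \<theta>, - unit_vec \<theta>)) \<in> borel \<rightarrow>\<^sub>M borel"
      unfolding borel_prod[symmetric] by measurable
    have [measurable]: "(\<lambda>\<theta>. \<phi> (unit_vec \<theta>, unit_vec \<theta>)) \<in> borel_measurable borel"
      "(\<lambda>\<theta>. \<phi> (unit_vec \<theta>, - unit_vec \<theta>)) \<in> borel_measurable borel"
      by (rule measurable_compose[OF _ assms(1)], measurable)+
    have [measurable]: "phase_average \<phi> \<in> borel_measurable borel"
      unfolding phase_average_def by measurable
    have "\<bar>phase_average \<phi> \<theta> + B\<bar> \<le> 2 * B" for \<theta>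
      using abs_phase_average_le[of \<phi> B \<theta>, OF B] \<open>0 \<le> B\<close> by linarith
    then show "(\<lambda>\<theta>. (phase_average \<phi> \<theta> + B) * exp_weight \<theta>\<^sub>0 \<theta>) integrable_on {\<theta>\<^sub>0 - 2 * pi..\<theta>\<^sub>0}"
      by (intro set_borel_integral_eq_integral(1) set_integrable_exp_average) measurable
    show "(\<lambda>\<theta>. B * exp_weight \<theta>\<^sub>0 \<theta>) integrable_on {\<theta>\<^sub>0 - 2 * pi..\<theta>\<^sub>0}"
      by (intro set_borel_integral_eq_integral(1) set_integrable_exp_average[where B = B])
         (use \<open>0 \<le> B\<close> in auto)
  qed
  also have "\<dots> = exp_average (phase_average \<phi>) \<theta>\<^sub>0"
    unfolding exp_average_def by (simp add: algebra_simps)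
  finally show ?thesis .
qed

lemma exp_average_periodic:
  assumes "continuous_on UNIV g" and per: "\<And>\<theta>. g (\<theta> + 2 * pi) = g \<theta>"
  shows "exp_average g (x + 2 * pi) = exp_average g x"
proof -
  let ?h = "\<lambda>\<theta>. g \<theta> * exp_weight (x + 2 * pi) \<theta>"
  have "exp_average g (x + 2 * pi) = integral {(x - 2 * pi) + 2 * pi..x + 2 * pi} ?h"
    by (simp add: exp_average_def)
  also have "\<dots> = integral {x - 2 * pi..x} (?h \<circ> (\<lambda>\<theta>. \<theta> + 2 * pi))"
    by (rule integral_shift[symmetric])
       (intro continuous_intros continuous_on_subset[OF assms(1)] subset_UNIV)
  also have "\<dots> = exp_average g x"
    by (simp add: exp_average_def exp_weight_def o_def per)
  finally show ?thesis .
qed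

lemma exp_average_periodic_nat:
  assumes "continuous_on UNIV g" "\<And>\<theta>. g (\<theta> + 2 * pi) = g \<theta>"
  shows "exp_average g (x + 2 * pi * real n) = exp_average g x"
proof (induction n)
  case (Suc n)
  have "exp_average g (x + 2 * pi * real (Suc n)) = exp_average g ((x + 2 * pi * real n) + 2 * pi)"
    by (simp add: algebra_simps)
  then show ?case
    using exp_average_periodic[OF assms] Suc by simp
qed simp

lemma exp_average_bounded:
  assumes "continuous_on UNIV g" "\<And>\<theta>. \<bar>g \<theta>\<bar> \<le> B"
  shows "\<bar>exp_average g x\<bar> \<le> B * exp_weight 0 0 * (2 * pi)"
proof -
  have "norm (integral {x - 2 * pi..x} (\<lambda>\<theta>. g \<theta> * exp_weight x \<theta>)) \<le>
      B * exp_weight 0 0 * (x - (x - 2 * pi))"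
  proof (rule integral_bound)
    show "norm (g \<theta> * exp_weight x \<theta>) \<le> B * exp_weight 0 0" if "\<theta> \<in> {x - 2 * pi..x}" for \<theta>
      using abs_mult_exp_weight_le[OF assms(2)] that by simp
    show "continuous_on {x - 2 * pi..x} (\<lambda>\<theta>. g \<theta> * exp_weight x \<theta>)"
      by (intro continuous_intros continuous_on_subset[OF assms(1)] subset_UNIV)
  qed simp
  then show ?thesis
    by (simp add: exp_average_def)
qed

text \<open>The differential equation \<open>G' = g - G\<close> of the exponential averages \<open>G\<close> of a periodic \<open>g\<close>.\<close>

lemma DERIV_exp_average:
  assumes cont: "continuous_on UNIV g" and per: "\<And>\<theta>. g (\<theta> + 2 * pi) = g \<theta>"
  shows "(exp_average g has_real_derivative g x - exp_average g x) (at x)"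
proof -
  define h where "h = (\<lambda>\<theta>. g \<theta> * exp \<theta>)"
  define a where "a = x - 2 * pi - 1"
  define H where "H = (\<lambda>y. integral {a..y} h)"
  define W where "W = 1 - exp (- 2 * pi)"
  have "W \<noteq> 0"
    using exp_2pi_less_1 by (simp add: W_def)
  have h_cont: "continuous_on A h" for A
    unfolding h_def by (intro continuous_intros continuous_on_subset[OF cont]) auto
  have h_int: "h integrable_on {c..d}" for c d
    by (rule integrable_continuous_real[OF h_cont])
  have H_deriv: "(H has_real_derivative h y) (at y)" if "a < y" for y
    using integral_has_real_derivative[OF h_cont, of y a "y + 1"] that
    by (simp add: H_def at_within_Icc_at)
  have H2: "((\<lambda>y. H (y - 2 * pi)) has_real_derivative h (x - 2 * pi)) (at x)"
  proof -
    have "((\<lambda>y. y - 2 * pi) has_real_derivative 1) (at x)"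
      by (auto intro!: derivative_eq_intros)
    then show ?thesis
      using DERIV_chain2[of H "h (x - 2 * pi)" "\<lambda>y. y - 2 * pi" x 1 UNIV] H_deriv[of "x - 2 * pi"]
      by (simp add: a_def)
  qed
  have eq: "exp (- y) / W * (H y - H (y - 2 * pi)) = exp_average g y" if "y \<in> {x - 1<..}" for y
  proof -
    have "H y - H (y - 2 * pi) = integral {y - 2 * pi..y} h"
      using Henstock_Kurzweil_Integration.integral_combine[of a "y - 2 * pi" y h] that h_int
      by (simp add: H_def a_def)
    moreover have "exp (- y) / W * integral {y - 2 * pi..y} h = exp_average g y"
      unfolding exp_average_def exp_weight_def W_def[symmetric] integral_mult_right[symmetric]
      by (intro integral_cong) (simp add: h_def exp_diff exp_minus field_simps)
    ultimately show ?thesis by simp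
  qed
  have "((\<lambda>y. exp (- y) / W * (H y - H (y - 2 * pi))) has_real_derivative
      - exp (- x) / W * (H x - H (x - 2 * pi)) + exp (- x) / W * (h x - h (x - 2 * pi))) (at x)"
  proof -
    have E: "((\<lambda>y. exp (- y) / W) has_real_derivative - exp (- x) / W) (at x)"
      using \<open>W \<noteq> 0\<close> by (auto intro!: derivative_eq_intros)
    have "(H has_real_derivative h x) (at x)"
      by (rule H_deriv) (unfold a_def, use pi_gt_zero in linarith)
    from DERIV_mult[OF E DERIV_diff[OF this H2]] show ?thesis
      by (rule DERIV_cong) (simp add: mult.commute)
  qed
  moreover have "exp (- x) / W * (h x - h (x - 2 * pi)) = g x"
  proof -
    have "h x - h (x - 2 * pi) = g x * exp x * W"
      using per[of "x - 2 * pi"] by (simp add: h_def W_def exp_diff exp_minus field_simps)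
    then show ?thesis
      using \<open>W \<noteq> 0\<close> by (simp add: exp_minus field_simps)
  qed
  ultimately have "((\<lambda>y. exp (- y) / W * (H y - H (y - 2 * pi))) has_real_derivative
      g x - exp_average g x) (at x)"
    using eq[of x] by simp
  then show ?thesis
    by (rule has_field_derivative_transform_within_open[where S = "{x - 1<..}"]) (simp_all only: eq, simp_all)
qed

text \<open>By the differential equation, \<open>T * G (ln T + C)\<close> is a primitive of \<open>g (ln T + C)\<close>. It extends
  continuously by \<open>0\<close> to \<open>T = 0\<close>, as \<open>G\<close> is bounded.\<close>

lemma has_integral_ln_average:
  assumes cont: "continuous_on UNIV g" and per: "\<And>\<theta>. g (\<theta> + 2 * pi) = g \<theta>"
    and B: "\<And>\<theta>. \<bar>g \<theta>\<bar> \<le> B" and "0 < T"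
  shows "((\<lambda>t. g (ln t + C)) has_integral T * exp_average g (ln T + C)) {0..T}"
proof -
  let ?F = "\<lambda>t. t * exp_average g (ln t + C)"
  have deriv: "(?F has_real_derivative g (ln t + C)) (at t)" if "0 < t" for t
    using that
    by (auto intro!: derivative_eq_intros DERIV_chain2[OF DERIV_exp_average[OF cont per]])
  have "((\<lambda>t. g (ln t + C)) has_integral ?F T - ?F 0) {0..T}"
  proof (rule fundamental_theorem_of_calculus_interior)
    show "continuous_on {0..T} ?F"
      unfolding continuous_on_eq_continuous_within
    proof
      fix t assume t: "t \<in> {0..T}"
      show "continuous (at t within {0..T}) ?F"
      proof (cases "t = 0")
        case True
        let ?K = "B * exp_weight 0 0 * (2 * pi)"
        have "(?F \<longlongrightarrow> 0) (at 0 within {0..T})"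
        proof (rule tendsto_0_le[where K = ?K])
          show "((\<lambda>t. t) \<longlongrightarrow> 0) (at 0 within {0..T})"
            by (rule tendsto_ident_at)
          show "\<forall>\<^sub>F t in at 0 within {0..T}. norm (?F t) \<le> norm t * ?K"
            unfolding real_norm_def abs_mult
            by (intro always_eventually allI mult_left_mono exp_average_bounded[OF cont B]) auto
        qed
        then show ?thesis
          by (simp add: continuous_within True)
      next
        case False
        then show ?thesis
          using deriv[of t] t by (auto intro!: continuous_at_imp_continuous_within DERIV_isCont)
      qed
    qed
  qed (use deriv \<open>0 < T\<close> in \<open>auto simp: has_real_derivative_iff_has_vector_derivative[symmetric]\<close>)
  then show ?thesis
    by simp
qed

section \<open>Asymptotics of the spiral\<close>

text \<open>The sign of the radial velocity on the piece from \<open>spiral i\<close> to \<open>spiral (Suc i)\<close>.\<close>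

definition radial_sign :: "nat \<Rightarrow> real" where
  "radial_sign i = (-1) ^ Suc i"

lemma radial_sign_cases: "radial_sign i = 1 \<or> radial_sign i = - 1"
  by (cases "even i") (auto simp: radial_sign_def)

lemma radial_sign_Suc: "radial_sign (Suc i) = - radial_sign i"
  by (simp add: radial_sign_def)

lemma abs_radial_sign [simp]: "\<bar>radial_sign i\<bar> = 1"
  using radial_sign_cases[of i] by auto

lemma radial_sign_mult_self [simp]: "radial_sign i * radial_sign i = 1"
  using radial_sign_cases[of i] by auto

lemma spiral_eq: "spiral i = (1 - radial_sign i / real i) *\<^sub>R unit_vec (angle i)"
  by (simp add: spiral_def radial_sign_def)

lemma angle_Suc: "1 \<le> i \<Longrightarrow> angle (Suc i) = angle i + 1 / (real (Suc i) * ln (real (Suc i)))"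
  by (simp add: angle_def)

lemma norm_spiral: "2 \<le> i \<Longrightarrow> norm (spiral i) = 1 - radial_sign i / real i"
  using radial_sign_cases[of i] by (auto simp: spiral_eq field_simps)

text \<open>Consecutive points have different norms, which bounds the steps below and makes the knots
  diverge like the harmonic series.\<close>

lemma step_spiral_ge:
  assumes "2 \<le> i"
  shows "1 / real i \<le> step spiral i"
proof -
  have "norm (spiral (Suc i)) - norm (spiral i) = radial_sign i * (1 / real i + 1 / real (Suc i))"
    using assms by (simp add: norm_spiral radial_sign_Suc distrib_left)
  then have "\<bar>norm (spiral (Suc i)) - norm (spiral i)\<bar> = 1 / real i + 1 / real (Suc i)"
    by (simp add: abs_mult)
  then have "1 / real i \<le> \<bar>norm (spiral (Suc i)) - norm (spiral i)\<bar>"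
    by simp
  also have "\<dots> \<le> step spiral i"
    unfolding step_def by (rule norm_triangle_ineq3)
  finally show ?thesis .
qed

lemma ln_Suc_le: "1 \<le> i \<Longrightarrow> ln (real (Suc i)) - ln (real i) \<le> 1 / real i"
proof -
  assume "1 \<le> i"
  then have "ln (real (Suc i)) - ln (real i) = ln (1 + 1 / real i)"
    using ln_div[of "real (Suc i)" "real i"] by (simp add: add_divide_distrib add.commute)
  also have "\<dots> \<le> 1 / real i"
    by (rule ln_add_one_self_le_self) simp
  finally show ?thesis .
qed

lemma ln_Suc_ge: "1 \<le> i \<Longrightarrow> 1 / real (Suc i) \<le> ln (real (Suc i)) - ln (real i)"
proof -
  assume "1 \<le> i"
  then have "ln (real i) - ln (real (Suc i)) = ln (real i / real (Suc i))"
    by (simp add: ln_div)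
  also have "\<dots> \<le> real i / real (Suc i) - 1"
    using \<open>1 \<le> i\<close> by (intro ln_le_minus_one) simp
  also have "\<dots> = - (1 / real (Suc i))"
    by (simp add: field_simps)
  finally show ?thesis by simp
qed

lemma knot_spiral_ge:
  assumes "2 \<le> n"
  shows "ln (real n) - ln 2 \<le> knot spiral n"
  using assms
proof (induction n rule: dec_induct)
  case (step n)
  then show ?case
    using ln_Suc_le[of n] step_spiral_ge[of n] by (simp add: knot_def)
qed (simp add: knot_def)

lemma ln_nat_at_top: "filterlim (\<lambda>n. ln (real n)) at_top sequentially"
  by (rule filterlim_compose[OF ln_at_top filterlim_real_sequentially])

interpretation spiral: interpolated_sequence spiral
proof
  show "0 < step spiral i" if "2 \<le> i" for i
    using step_spiral_ge[OF that] that by (auto intro: less_le_trans[rotated])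
  have "filterlim (\<lambda>n. - ln 2 + ln (real n)) at_top sequentially"
    by (rule filterlim_tendsto_add_at_top[OF tendsto_const ln_nat_at_top])
  then show "filterlim (knot spiral) at_top sequentially"
    by (rule filterlim_at_top_mono)
       (use knot_spiral_ge in \<open>auto simp: eventually_sequentially intro!: exI[of _ 2]\<close>)
qed

lemma spiral_difference:
  assumes "1 \<le> i"
  shows "spiral (Suc i) - spiral i =
    (radial_sign i * (1 / real i + 1 / real (Suc i))) *\<^sub>R unit_vec (angle i) +
    (1 + radial_sign i / real (Suc i)) *\<^sub>R (unit_vec (angle (Suc i)) - unit_vec (angle i))"
proof -
  have "radial_sign i * (1 / real i + 1 / real (Suc i)) =
      (1 + radial_sign i / real (Suc i)) - (1 - radial_sign i / real i)"
    using assms by (simp add: field_simps)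
  moreover have "spiral (Suc i) = (1 + radial_sign i / real (Suc i)) *\<^sub>R unit_vec (angle (Suc i))"
    by (simp add: spiral_eq radial_sign_Suc)
  moreover have "c *\<^sub>R v - d *\<^sub>R u = (c - d) *\<^sub>R u + c *\<^sub>R (v - u)" for c d and u v :: "real ^ 2"
    by (simp add: algebra_simps)
  ultimately show ?thesis
    by (simp only: spiral_eq[of i])
qed

text \<open>The angular increments are of smaller order than the radial ones, so a step is, to leading
  order, \<open>\<plusminus> 2 / i\<close> times the radial unit vector.\<close>

lemma spiral_difference_tendsto:
  "(\<lambda>i. (real i * radial_sign i) *\<^sub>R (spiral (Suc i) - spiral i) - 2 *\<^sub>R unit_vec (angle i)) \<longlonglongrightarrow> 0"
proof (rule Lim_null_comparison)
  have "(\<lambda>i. 1 / real (Suc i)) \<longlonglongrightarrow> 0"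
    using LIMSEQ_inverse_real_of_nat by (simp add: inverse_eq_divide)
  moreover have "(\<lambda>i. 2 / ln (real (Suc i))) \<longlonglongrightarrow> 0"
    by (rule tendsto_divide_0[OF tendsto_const filterlim_at_top_imp_at_infinity])
       (rule filterlim_compose[OF ln_nat_at_top filterlim_Suc])
  ultimately show "(\<lambda>i. 1 / real (Suc i) + 2 / ln (real (Suc i))) \<longlonglongrightarrow> 0"
    using tendsto_add by fastforce
  show "\<forall>\<^sub>F i in sequentially. norm ((real i * radial_sign i) *\<^sub>R (spiral (Suc i) - spiral i) -
      2 *\<^sub>R unit_vec (angle i)) \<le> 1 / real (Suc i) + 2 / ln (real (Suc i))"
    using eventually_ge_at_top[of 1]
  proof eventually_elim
    case (elim i)
    let ?u = "unit_vec (angle i)" and ?v = "unit_vec (angle (Suc i)) - unit_vec (angle i)"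
    define a where "a = real i * radial_sign i * (radial_sign i * (1 / real i + 1 / real (Suc i)))"
    define b where "b = real i * radial_sign i * (1 + radial_sign i / real (Suc i))"
    have ln: "0 < ln (real (Suc i))"
      using elim by (intro ln_gt_zero) auto
    have "a = real i * (1 / real i + 1 / real (Suc i)) * (radial_sign i * radial_sign i)"
      unfolding a_def by (simp only: ac_simps)
    then have "a = 1 + real i / real (Suc i)"
      using elim by (simp add: distrib_left)
    then have a: "a - 2 = - (1 / real (Suc i))"
      by (simp add: field_simps)
    have "\<bar>1 + radial_sign i / real (Suc i)\<bar> \<le> 2"
      using radial_sign_cases[of i] by (auto simp: field_simps)
    then have b: "\<bar>b\<bar> \<le> real i * 2"
      unfolding b_def abs_mult by (simp add: mult_left_mono)
    have "norm ?v \<le> \<bar>angle (Suc i) - angle i\<bar>"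
      by (rule norm_unit_vec_diff)
    also have "\<dots> = 1 / (real (Suc i) * ln (real (Suc i)))"
      using elim ln by (simp add: angle_Suc)
    finally have v: "norm ?v \<le> 1 / (real (Suc i) * ln (real (Suc i)))" .
    have "(real i * radial_sign i) *\<^sub>R (spiral (Suc i) - spiral i) - 2 *\<^sub>R ?u = (a - 2) *\<^sub>R ?u + b *\<^sub>R ?v"
      unfolding spiral_difference[OF elim] scaleR_add_right scaleR_scaleR a_def b_def
      by (simp add: scaleR_diff_left)
    then have "norm ((real i * radial_sign i) *\<^sub>R (spiral (Suc i) - spiral i) - 2 *\<^sub>R ?u)
        \<le> norm ((a - 2) *\<^sub>R ?u) + norm (b *\<^sub>R ?v)"
      by (simp only: norm_triangle_ineq)
    also have "norm ((a - 2) *\<^sub>R ?u) = 1 / real (Suc i)"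
      unfolding a by simp
    also have "norm (b *\<^sub>R ?v) \<le> (real i * 2) * (1 / (real (Suc i) * ln (real (Suc i))))"
      unfolding norm_scaleR using b v by (intro mult_mono) auto
    also have "\<dots> = (real i / real (Suc i)) * (2 / ln (real (Suc i)))"
      by simp
    also have "\<dots> \<le> 2 / ln (real (Suc i))"
      using ln by (intro mult_left_le_one_le) auto
    finally show ?case by simp
  qed
qed

lemma step_spiral_asymp: "(\<lambda>i. real i * step spiral i) \<longlonglongrightarrow> 2"
proof -
  have "(\<lambda>i. real i * step spiral i - 2) \<longlonglongrightarrow> 0"
  proof (rule tendsto_0_le[OF spiral_difference_tendsto, where K = 1], rule always_eventually, rule allI)
    fix i
    have "real i * step spiral i - 2 =
        norm ((real i * radial_sign i) *\<^sub>R (spiral (Suc i) - spiral i)) - norm (2 *\<^sub>R unit_vec (angle i))"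
      by (simp add: step_def abs_mult)
    then show "norm (real i * step spiral i - 2) \<le>
        norm ((real i * radial_sign i) *\<^sub>R (spiral (Suc i) - spiral i) - 2 *\<^sub>R unit_vec (angle i)) * 1"
      by (simp only: real_norm_def mult_1_right norm_triangle_ineq3)
  qed
  then show ?thesis
    by (simp add: LIM_zero_iff)
qed

lemma step_spiral_tendsto_0: "step spiral \<longlonglongrightarrow> 0"
proof -
  have "(\<lambda>i. (real i * step spiral i) * (1 / real i)) \<longlonglongrightarrow> 2 * 0"
    by (intro tendsto_mult step_spiral_asymp lim_1_over_n)
  moreover have "\<forall>\<^sub>F i in sequentially. (real i * step spiral i) * (1 / real i) = step spiral i"
    using eventually_gt_at_top[of 0] by eventually_elim simp
  ultimately show ?thesis
    using tendsto_cong by fastforce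
qed

lemma step_spiral_ratio: "(\<lambda>i. step spiral (Suc i) / step spiral i) \<longlonglongrightarrow> 1"
proof -
  have "(\<lambda>i. (real (Suc i) * step spiral (Suc i)) / (real i * step spiral i) * (real i / real (Suc i)))
      \<longlonglongrightarrow> 2 / 2 * 1"
    by (intro tendsto_mult tendsto_divide step_spiral_asymp LIMSEQ_n_over_Suc_n
        LIMSEQ_Suc[OF step_spiral_asymp]) simp
  moreover have "\<forall>\<^sub>F i in sequentially.
      (real (Suc i) * step spiral (Suc i)) / (real i * step spiral i) * (real i / real (Suc i)) =
      step spiral (Suc i) / step spiral i"
    using eventually_ge_at_top[of 2]
  proof eventually_elim
    case (elim i)
    have "(m * b) / (n * a) * (n / m) = b / a" if "m \<noteq> 0" "n \<noteq> 0" for m n a b :: real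
      using that by simp
    with elim show ?case
      by simp
  qed
  ultimately show ?thesis
    using tendsto_cong by fastforce
qed

lemma velocity_spiral_tendsto:
  "(\<lambda>i. spiral.velocity i - radial_sign i *\<^sub>R unit_vec (angle i)) \<longlonglongrightarrow> 0"
proof -
  let ?w = "\<lambda>i. (real i * radial_sign i) *\<^sub>R (spiral (Suc i) - spiral i)"
  let ?e = "\<lambda>i. real i * step spiral i"
  have "(\<lambda>i. 2 / ?e i - 1) \<longlonglongrightarrow> 2 / 2 - 1"
    by (intro tendsto_intros step_spiral_asymp) simp
  then have "(\<lambda>i. \<bar>2 / ?e i - 1\<bar>) \<longlonglongrightarrow> 0"
    by (simp add: tendsto_rabs_zero)
  moreover have "(\<lambda>i. norm (?w i - 2 *\<^sub>R unit_vec (angle i)) / ?e i) \<longlonglongrightarrow> 0 / 2"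
    by (intro tendsto_divide tendsto_norm_zero spiral_difference_tendsto step_spiral_asymp) simp
  ultimately have lim: "(\<lambda>i. norm (?w i - 2 *\<^sub>R unit_vec (angle i)) / ?e i + \<bar>2 / ?e i - 1\<bar>) \<longlonglongrightarrow> 0"
    using tendsto_add by fastforce
  show ?thesis
  proof (rule Lim_null_comparison[OF _ lim])
    show "\<forall>\<^sub>F i in sequentially. norm (spiral.velocity i - radial_sign i *\<^sub>R unit_vec (angle i)) \<le>
        norm (?w i - 2 *\<^sub>R unit_vec (angle i)) / ?e i + \<bar>2 / ?e i - 1\<bar>"
      using eventually_ge_at_top[of 2]
    proof eventually_elim
      case (elim i)
      let ?u = "unit_vec (angle i)"
      have e: "0 < ?e i"
        using elim spiral.step_pos[of i] by simp
      have "spiral.velocity i = (radial_sign i / ?e i) *\<^sub>R ?w i"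
        using elim by (simp add: spiral.velocity_def radial_sign_mult_self[unfolded mult.assoc])
      then have "spiral.velocity i - radial_sign i *\<^sub>R ?u =
          (radial_sign i / ?e i) *\<^sub>R (?w i - 2 *\<^sub>R ?u) + (radial_sign i * (2 / ?e i - 1)) *\<^sub>R ?u"
        by (simp add: scaleR_diff_right scaleR_diff_left right_diff_distrib)
      then have "norm (spiral.velocity i - radial_sign i *\<^sub>R ?u) \<le>
          norm ((radial_sign i / ?e i) *\<^sub>R (?w i - 2 *\<^sub>R ?u)) + norm ((radial_sign i * (2 / ?e i - 1)) *\<^sub>R ?u)"
        by (simp only: norm_triangle_ineq)
      also have "\<dots> = norm (?w i - 2 *\<^sub>R ?u) / ?e i + \<bar>2 / ?e i - 1\<bar>"
        using e abs_of_pos[OF e] by (simp only: norm_scaleR abs_divide abs_radial_sign norm_unit_vec abs_mult[of "radial_sign i"]) simp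
      finally show ?case .
    qed
  qed
qed

text \<open>The integral test compares \<open>angle\<close> with the primitive \<open>ln \<circ> ln\<close> of its summands.\<close>

lemma angle_asymp: "convergent (\<lambda>i. angle i - ln (ln (real i)))"
proof -
  define f where "f = (\<lambda>y::real. 1 / ((y + 2) * ln (y + 2)))"
  have pos: "0 < ln (y + 2)" if "0 \<le> y" for y :: real
    using that by (intro ln_gt_zero) auto
  interpret f: antimono_fun_sum_integral_diff f
  proof
    show "f y \<le> f z" if "0 \<le> z" "z \<le> y" for y z
      unfolding f_def using that pos[of y] pos[of z] by (intro divide_left_mono mult_mono mult_pos_pos) auto
    show "0 \<le> f y" if "0 \<le> y" for y
      unfolding f_def using that pos[of y] by simp
    show "continuous_on {0..} f"
      unfolding f_def using pos by (intro continuous_intros) (force dest: less_imp_neq)+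
  qed
  have "f.sum_integral_diff_series n = angle (n + 2) - ln (ln (real (n + 2))) + ln (ln 2)" for n
  proof -
    have "(\<Sum>k\<le>n. f (real k)) = angle (n + 2)"
    proof (induction n)
      case 0
      show ?case by (simp add: f_def angle_def)
    next
      case (Suc n)
      then show ?case
        using angle_Suc[of "n + 2"] by (simp add: f_def add.commute)
    qed
    moreover have "(f has_integral ln (ln (real n + 2)) - ln (ln (0 + 2))) {0..real n}"
    proof (rule fundamental_theorem_of_calculus)
      show "((\<lambda>y. ln (ln (y + 2))) has_vector_derivative f y) (at y within {0..real n})"
        if "y \<in> {0..real n}" for y
        using that pos[of y] unfolding has_real_derivative_iff_has_vector_derivative[symmetric] f_def
        by (auto intro!: derivative_eq_intros simp: field_simps)
    qed simp
    ultimately show ?thesis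
      unfolding f.sum_integral_diff_series_def by (simp add: integral_unique add.commute)
  qed
  then have "convergent (\<lambda>n. (angle (n + 2) - ln (ln (real (n + 2)))) + ln (ln 2))"
    using f.sum_integral_diff_series_convergent by presburger
  then show ?thesis
    unfolding convergent_add_const_right_iff
    by (rule convergent_ignore_initial_segment[THEN iffD1, rotated])
qed

text \<open>By the Stolz--Cesaro theorem, as the increments are asymptotic to \<open>1 / i\<close> and \<open>2 / i\<close>.\<close>

lemma knot_spiral_asymp: "(\<lambda>n. ln (real n) / knot spiral n) \<longlonglongrightarrow> 1 / 2"
proof -
  define Q where "Q = (\<lambda>n. ln (real n) - knot spiral n / 2)"
  have ln_lim: "(\<lambda>i. real i * (ln (real (Suc i)) - ln (real i))) \<longlonglongrightarrow> 1"
  proof (rule tendsto_sandwich)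
    show "(\<lambda>i. real i / real (Suc i)) \<longlonglongrightarrow> 1"
      by (rule LIMSEQ_n_over_Suc_n)
    show "\<forall>\<^sub>F i in sequentially. real i / real (Suc i) \<le> real i * (ln (real (Suc i)) - ln (real i))"
      using eventually_ge_at_top[of 1]
    proof eventually_elim
      case (elim i)
      then show ?case
        using mult_left_mono[OF ln_Suc_ge[of i], of "real i"] by simp
    qed
    show "\<forall>\<^sub>F i in sequentially. real i * (ln (real (Suc i)) - ln (real i)) \<le> 1"
      using eventually_ge_at_top[of 1]
    proof eventually_elim
      case (elim i)
      then show ?case
        using mult_left_mono[OF ln_Suc_le[of i], of "real i"] by simp
    qed
  qed simp
  have "(\<lambda>i. (real i * (ln (real (Suc i)) - ln (real i))) / (real i * step spiral i) - 1 / 2) \<longlonglongrightarrow> 1 / 2 - 1 / 2"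
    by (intro tendsto_intros ln_lim step_spiral_asymp) simp
  moreover have "\<forall>\<^sub>F i in sequentially.
      (real i * (ln (real (Suc i)) - ln (real i))) / (real i * step spiral i) - 1 / 2 =
      (Q (Suc i) - Q i) / step spiral i"
    using eventually_ge_at_top[of 2]
  proof eventually_elim
    case (elim i)
    have "Q (Suc i) - Q i = (ln (real (Suc i)) - ln (real i)) - step spiral i / 2"
      unfolding Q_def spiral.knot_Suc[OF elim] by (simp add: add_divide_distrib)
    then show ?case
      using elim spiral.step_pos[OF elim] by (simp add: diff_divide_distrib)
  qed
  ultimately have "(\<lambda>i. (Q (Suc i) - Q i) / step spiral i) \<longlonglongrightarrow> 0"
    using tendsto_cong by fastforce
  then have "(\<lambda>n. Q n / knot spiral n + 1 / 2) \<longlonglongrightarrow> 0 + 1 / 2"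
    by (intro tendsto_add spiral.tendsto_div_knot tendsto_const)
  moreover have "\<forall>\<^sub>F n in sequentially. Q n / knot spiral n + 1 / 2 = ln (real n) / knot spiral n"
    using spiral.knot_at_top[unfolded filterlim_at_top_dense, rule_format, of 0]
    by eventually_elim (simp add: Q_def diff_divide_distrib)
  ultimately show ?thesis
    using tendsto_cong by fastforce
qed

lemma angle_knot_convergent:
  obtains C where "(\<lambda>n. angle n - ln (knot spiral n)) \<longlonglongrightarrow> C"
proof -
  obtain c where "(\<lambda>n. angle n - ln (ln (real n))) \<longlonglongrightarrow> c"
    using angle_asymp by (auto simp: convergent_def)
  moreover have "(\<lambda>n. ln (ln (real n) / knot spiral n)) \<longlonglongrightarrow> ln (1 / 2)"
    by (intro tendsto_ln knot_spiral_asymp) simp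
  ultimately have "(\<lambda>n. (angle n - ln (ln (real n))) + ln (ln (real n) / knot spiral n)) \<longlonglongrightarrow> c + ln (1 / 2)"
    by (rule tendsto_add)
  moreover have "\<forall>\<^sub>F n in sequentially. (angle n - ln (ln (real n))) + ln (ln (real n) / knot spiral n) =
      angle n - ln (knot spiral n)"
    using spiral.knot_at_top[unfolded filterlim_at_top_dense, rule_format, of 0]
      ln_nat_at_top[unfolded filterlim_at_top_dense, rule_format, of 0]
    by eventually_elim (simp add: ln_div)
  ultimately have "(\<lambda>n. angle n - ln (knot spiral n)) \<longlonglongrightarrow> c + ln (1 / 2)"
    using tendsto_cong by fastforce
  then show thesis
    by (rule that)
qed

lemma angle_piece_tendsto:
  assumes C: "(\<lambda>n. angle n - ln (knot spiral n)) \<longlonglongrightarrow> C"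
  shows "((\<lambda>t. angle (piece spiral t) - (ln t + C)) \<longlongrightarrow> 0) at_top"
proof -
  let ?p = "piece spiral"
  have "((\<lambda>t. angle (?p t) - ln (knot spiral (?p t))) \<longlongrightarrow> C) at_top"
    by (rule filterlim_compose[OF C spiral.piece_at_top])
  moreover have "((\<lambda>t. ln t - ln (knot spiral (?p t))) \<longlongrightarrow> 0) at_top"
  proof (rule Lim_null_comparison)
    have "(\<lambda>i. step spiral i / knot spiral i) \<longlonglongrightarrow> 0"
      by (rule tendsto_divide_0[OF step_spiral_tendsto_0
            filterlim_at_top_imp_at_infinity[OF spiral.knot_at_top]])
    from filterlim_compose[OF this spiral.piece_at_top]
    show "((\<lambda>t. step spiral (?p t) / knot spiral (?p t)) \<longlongrightarrow> 0) at_top" .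
    show "\<forall>\<^sub>F t in at_top. norm (ln t - ln (knot spiral (?p t))) \<le> step spiral (?p t) / knot spiral (?p t)"
      using eventually_ge_at_top[of 0]
        filterlim_compose[OF spiral.knot_at_top spiral.piece_at_top,
          unfolded filterlim_at_top_dense, rule_format, of 0]
    proof eventually_elim
      case (elim t)
      let ?k = "knot spiral (?p t)"
      have t: "?k \<le> t" "t < ?k + step spiral (?p t)"
        using spiral.piece_bounds[of t] elim by (auto simp: spiral.knot_Suc)
      have "ln t - ln ?k = ln (t / ?k)"
        using elim t by (simp add: ln_div)
      also have "\<dots> \<le> t / ?k - 1"
        using elim t by (intro ln_le_minus_one) simp
      also have "\<dots> \<le> step spiral (?p t) / ?k"
      proof -
        have "t / ?k \<le> (?k + step spiral (?p t)) / ?k"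
          using elim t by (intro divide_right_mono) auto
        then show ?thesis
          using elim by (simp add: add_divide_distrib)
      qed
      finally have "ln t - ln ?k \<le> step spiral (?p t) / ?k" .
      moreover have "ln ?k \<le> ln t"
        using elim t by simp
      ultimately show ?case by simp
    qed
  qed
  ultimately have "((\<lambda>t. (angle (?p t) - ln (knot spiral (?p t))) - (ln t - ln (knot spiral (?p t))) - C)
      \<longlongrightarrow> C - 0 - C) at_top"
    by (intro tendsto_intros)
  then show ?thesis
    by (simp add: algebra_simps)
qed

lemma interp_curve_spiral_tendsto:
  "((\<lambda>t. interp_curve spiral t - unit_vec (angle (piece spiral t))) \<longlongrightarrow> 0) at_top"
proof (rule Lim_null_comparison)
  let ?p = "piece spiral"
  have "(\<lambda>i. step spiral i + 1 / real i) \<longlonglongrightarrow> 0 + 0"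
    by (intro tendsto_add step_spiral_tendsto_0 lim_1_over_n)
  from filterlim_compose[OF this spiral.piece_at_top]
  show "((\<lambda>t. step spiral (?p t) + 1 / real (?p t)) \<longlongrightarrow> 0) at_top"
    by simp
  show "\<forall>\<^sub>F t in at_top. norm (interp_curve spiral t - unit_vec (angle (?p t))) \<le>
      step spiral (?p t) + 1 / real (?p t)"
    using eventually_ge_at_top[of 0]
  proof eventually_elim
    case (elim t)
    let ?i = "?p t"
    let ?r = "(t - knot spiral ?i) / step spiral ?i"
    have i: "2 \<le> ?i" "knot spiral ?i \<le> t" "t < knot spiral ?i + step spiral ?i"
      using spiral.piece_bounds[OF elim] by (auto simp: spiral.knot_Suc)
    then have r: "0 \<le> ?r" "?r \<le> 1"
      using spiral.step_pos[of ?i] by (auto simp: divide_simps)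
    have "interp_curve spiral t - unit_vec (angle ?i) =
        ?r *\<^sub>R (spiral (Suc ?i) - spiral ?i) + (- (radial_sign ?i / real ?i)) *\<^sub>R unit_vec (angle ?i)"
      by (simp add: interp_curve_def Let_def spiral_eq[of ?i] scaleR_diff_left)
    then have "norm (interp_curve spiral t - unit_vec (angle ?i)) \<le>
        norm (?r *\<^sub>R (spiral (Suc ?i) - spiral ?i)) + norm ((- (radial_sign ?i / real ?i)) *\<^sub>R unit_vec (angle ?i))"
      by (simp only: norm_triangle_ineq)
    also have "norm (?r *\<^sub>R (spiral (Suc ?i) - spiral ?i)) = ?r * step spiral ?i"
      unfolding norm_scaleR abs_of_nonneg[OF r(1)] by (simp add: step_def)
    also have "\<dots> \<le> step spiral ?i"
      using r spiral.step_pos[of ?i] i by (intro mult_left_le_one_le) auto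
    also have "norm ((- (radial_sign ?i / real ?i)) *\<^sub>R unit_vec (angle ?i)) = 1 / real ?i"
      by simp
    finally show ?case by simp
  qed
qed

section \<open>Averages along the spiral\<close>

text \<open>Half the difference of the values of \<open>\<phi>\<close> at the two phase points above an angle. The value at
  the point with velocity \<open>s *\<^sub>R unit_vec \<theta>\<close>, \<open>s = \<plusminus>1\<close>, is the phase average plus \<open>s\<close> times this.\<close>

definition phase_odd :: "((real ^ 2) \<times> (real ^ 2) \<Rightarrow> real) \<Rightarrow> real \<Rightarrow> real" where
  "phase_odd \<phi> \<theta> = (\<phi> (unit_vec \<theta>, unit_vec \<theta>) - \<phi> (unit_vec \<theta>, - unit_vec \<theta>)) / 2"

lemma abs_phase_odd_le:
  assumes "\<And>z. \<bar>\<phi> z\<bar> \<le> B"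
  shows "\<bar>phase_odd \<phi> \<theta>\<bar> \<le> B"
proof -
  have "\<bar>(a - b) / 2\<bar> \<le> B" if "\<bar>a\<bar> \<le> B" "\<bar>b\<bar> \<le> B" for a b :: real
    using that by (simp add: abs_le_iff field_simps)
  then show ?thesis
    unfolding phase_odd_def using assms by blast
qed

context
  fixes \<phi> :: "(real ^ 2) \<times> (real ^ 2) \<Rightarrow> real"
  assumes cont: "continuous_on UNIV \<phi>"
begin

lemma tendsto_phase_diff:
  assumes "\<forall>\<^sub>F t in G. norm (p t) \<le> K" "\<forall>\<^sub>F t in G. norm (q t) \<le> K"
    and lim: "((\<lambda>t. p t - q t) \<longlongrightarrow> 0) G"
  shows "((\<lambda>t. \<phi> (p t) - \<phi> (q t)) \<longlongrightarrow> 0) G"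
proof (rule tendsto_diff_uniformly_continuous[where f = \<phi> and p = p and q = q and S = "cball 0 K"])
  show "uniformly_continuous_on (cball 0 K) \<phi>"
    by (rule compact_uniformly_continuous[OF continuous_on_subset[OF cont]]) auto
  show "((\<lambda>t. dist (p t) (q t)) \<longlongrightarrow> 0) G"
    unfolding dist_norm using lim by (rule tendsto_norm_zero)
qed (use assms in simp_all)

lemma tendsto_phase_angle_diff:
  assumes "((\<lambda>t. \<theta> t - \<eta> t) \<longlongrightarrow> 0) G"
  shows "((\<lambda>t. \<phi> (unit_vec (\<theta> t), c *\<^sub>R unit_vec (\<theta> t)) - \<phi> (unit_vec (\<eta> t), c *\<^sub>R unit_vec (\<eta> t))) \<longlongrightarrow> 0) G"
proof (rule tendsto_phase_diff[where K = "1 + \<bar>c\<bar>"])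
  have bound: "norm (u, c *\<^sub>R u) \<le> (1 + \<bar>c\<bar>) * norm u" for u :: "real ^ 2"
    using norm_Pair_le[of u "c *\<^sub>R u"] by (simp add: algebra_simps)
  show "\<forall>\<^sub>F t in G. norm (unit_vec (\<theta> t), c *\<^sub>R unit_vec (\<theta> t)) \<le> 1 + \<bar>c\<bar>"
    "\<forall>\<^sub>F t in G. norm (unit_vec (\<eta> t), c *\<^sub>R unit_vec (\<eta> t)) \<le> 1 + \<bar>c\<bar>"
    using bound[of "unit_vec _"] by auto
  have "norm ((unit_vec a, c *\<^sub>R unit_vec a) - (unit_vec b, c *\<^sub>R unit_vec b)) \<le> norm (a - b) * (1 + \<bar>c\<bar>)" for a b
    using order_trans[OF bound[of "unit_vec a - unit_vec b"] mult_left_mono[OF norm_unit_vec_diff[of a b]]]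
    by (simp add: scaleR_diff_right mult.commute)
  then show "((\<lambda>t. (unit_vec (\<theta> t), c *\<^sub>R unit_vec (\<theta> t)) - (unit_vec (\<eta> t), c *\<^sub>R unit_vec (\<eta> t))) \<longlongrightarrow> 0) G"
    by (intro tendsto_0_le[OF assms, where K = "1 + \<bar>c\<bar>"] always_eventually allI)
qed

text \<open>Along the curve, \<open>\<phi>\<close> is asymptotically its value at the outward or the inward phase point.\<close>

lemma tendsto_along_curve:
  assumes C: "(\<lambda>n. angle n - ln (knot spiral n)) \<longlonglongrightarrow> C"
  defines "p \<equiv> piece spiral"
  shows "((\<lambda>t. \<phi> (interp_curve spiral t, spiral.velocity (p t)) - phase_average \<phi> (ln t + C) -
      radial_sign (p t) * phase_odd \<phi> (angle (p t))) \<longlongrightarrow> 0) at_top"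
proof -
  let ?q = "\<lambda>t. (unit_vec (angle (p t)), radial_sign (p t) *\<^sub>R unit_vec (angle (p t)))"
  let ?z = "\<lambda>t. (interp_curve spiral t, spiral.velocity (p t))"
  have z: "((\<lambda>t. ?z t - ?q t) \<longlongrightarrow> 0) at_top"
    using tendsto_Pair[OF interp_curve_spiral_tendsto
        filterlim_compose[OF velocity_spiral_tendsto spiral.piece_at_top]]
    by (simp add: p_def zero_prod_def)
  have q_le: "norm (?q t) \<le> 2" for t
    using norm_Pair_le[of "unit_vec (angle (p t))" "radial_sign (p t) *\<^sub>R unit_vec (angle (p t))"] by simp
  have "\<forall>\<^sub>F t in at_top. dist (?z t - ?q t) 0 < 1"
    using z by (rule tendstoD) simp
  then have "\<forall>\<^sub>F t in at_top. norm (?z t) \<le> 3"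
  proof eventually_elim
    case (elim t)
    then show ?case
      using norm_triangle_sub[of "?z t" "?q t"] q_le[of t] by (simp only: dist_norm) simp
  qed
  then have "((\<lambda>t. \<phi> (?z t) - \<phi> (?q t)) \<longlongrightarrow> 0) at_top"
    using q_le by (intro tendsto_phase_diff[OF _ _ z, where K = 3]) (simp_all add: order_trans[OF q_le])
  moreover have "((\<lambda>t. phase_average \<phi> (angle (p t)) - phase_average \<phi> (ln t + C)) \<longlongrightarrow> 0) at_top"
  proof -
    note * = tendsto_phase_angle_diff[OF angle_piece_tendsto[OF C]]
    have "((\<lambda>t. ((\<phi> (unit_vec (angle (p t)), 1 *\<^sub>R unit_vec (angle (p t))) -
             \<phi> (unit_vec (ln t + C), 1 *\<^sub>R unit_vec (ln t + C))) +
           (\<phi> (unit_vec (angle (p t)), (- 1) *\<^sub>R unit_vec (angle (p t))) -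
             \<phi> (unit_vec (ln t + C), (- 1) *\<^sub>R unit_vec (ln t + C)))) / 2) \<longlongrightarrow> (0 + 0) / 2) at_top"
      unfolding p_def by (intro tendsto_intros *) simp
    then show ?thesis
      by (simp add: phase_average_def diff_divide_distrib add_divide_distrib algebra_simps)
  qed
  ultimately have "((\<lambda>t. (\<phi> (?z t) - \<phi> (?q t)) +
      (phase_average \<phi> (angle (p t)) - phase_average \<phi> (ln t + C))) \<longlongrightarrow> 0 + 0) at_top"
    by (rule tendsto_add)
  moreover have "\<phi> (?q t) = phase_average \<phi> (angle (p t)) + radial_sign (p t) * phase_odd \<phi> (angle (p t))" for t
    using radial_sign_cases[of "p t"] by (auto simp: phase_average_def phase_odd_def field_simps)
  ultimately show ?thesis
    by (simp add: algebra_simps)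
qed

lemma phase_odd_increment_tendsto:
  "(\<lambda>i. phase_odd \<phi> (angle i) - phase_odd \<phi> (angle (Suc i))) \<longlonglongrightarrow> 0"
proof -
  have "(\<lambda>i. 1 / real (Suc i)) \<longlonglongrightarrow> 0"
    using LIMSEQ_inverse_real_of_nat by (simp add: inverse_eq_divide)
  moreover have "(\<lambda>i. 1 / ln (real (Suc i))) \<longlonglongrightarrow> 0"
    by (rule tendsto_divide_0[OF tendsto_const filterlim_at_top_imp_at_infinity])
       (rule filterlim_compose[OF ln_nat_at_top filterlim_Suc])
  ultimately have "(\<lambda>i. - (1 / real (Suc i) * (1 / ln (real (Suc i))))) \<longlonglongrightarrow> - (0 * 0)"
    by (intro tendsto_intros)
  moreover have "\<forall>\<^sub>F i in sequentially. - (1 / real (Suc i) * (1 / ln (real (Suc i)))) = angle i - angle (Suc i)"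
    using eventually_ge_at_top[of 1] by eventually_elim (simp add: angle_Suc)
  ultimately have "(\<lambda>i. angle i - angle (Suc i)) \<longlonglongrightarrow> 0"
    using tendsto_cong by fastforce
  note * = tendsto_phase_angle_diff[OF this]
  have "(\<lambda>i. ((\<phi> (unit_vec (angle i), 1 *\<^sub>R unit_vec (angle i)) -
           \<phi> (unit_vec (angle (Suc i)), 1 *\<^sub>R unit_vec (angle (Suc i)))) -
         (\<phi> (unit_vec (angle i), (- 1) *\<^sub>R unit_vec (angle i)) -
           \<phi> (unit_vec (angle (Suc i)), (- 1) *\<^sub>R unit_vec (angle (Suc i))))) / 2) \<longlonglongrightarrow> (0 - 0) / 2"
    by (intro tendsto_intros *) simp
  then show ?thesis
    by (simp add: phase_odd_def add_divide_distrib diff_divide_distrib algebra_simps)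
qed

end

text \<open>The even part survives in the time average. The alternating odd part equals, up to a term
  tending to \<open>0\<close>, a telescoping function with bounded primitive, because consecutive pieces have
  asymptotically equal durations and angles.\<close>

lemma tendsto_curve_average:
  fixes \<phi> :: "(real ^ 2) \<times> (real ^ 2) \<Rightarrow> real"
  assumes cont: "continuous_on UNIV \<phi>" and B: "\<And>z. \<bar>\<phi> z\<bar> \<le> B"
    and C: "(\<lambda>n. angle n - ln (knot spiral n)) \<longlonglongrightarrow> C"
  shows "((\<lambda>T. (\<integral>z. \<phi> z \<partial>curve_measure (interp_curve spiral) {0..T}) -
      exp_average (phase_average \<phi>) (ln T + C)) \<longlongrightarrow> 0) at_top"
proof -
  let ?p = "piece spiral"
  define F where "F = (\<lambda>t. \<phi> (interp_curve spiral t, spiral.velocity (?p t)))"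
  define h where "h = (\<lambda>t. phase_average \<phi> (ln t + C))"
  define k where "k = (\<lambda>i. phase_odd \<phi> (angle i))"
  (* As the signs alternate, Q (Suc i) - Q i is radial_sign i times the mean of k j * step spiral j
     over j = i and j = Suc i. *)
  define Q where "Q = (\<lambda>i. - radial_sign i * k i * step spiral i / 2)"
  define \<tau> where "\<tau> = (\<lambda>t. (Q (Suc (?p t)) - Q (?p t)) / step spiral (?p t))"
  have k_le: "\<bar>k i\<bar> \<le> B" for i
    unfolding k_def using B by (rule abs_phase_odd_le)
  have "0 \<le> B"
    using k_le[of 0] by linarith
  have "(\<lambda>i. radial_sign i * k i - (Q (Suc i) - Q i) / step spiral i) \<longlonglongrightarrow> 0"
  proof (rule Lim_null_comparison)
    let ?r = "\<lambda>i. step spiral (Suc i) / step spiral i"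
    have "(\<lambda>i. (\<bar>k i - k (Suc i)\<bar> + \<bar>1 - ?r i\<bar> * B) / 2) \<longlonglongrightarrow> (\<bar>0\<bar> + \<bar>1 - 1\<bar> * B) / 2"
      unfolding k_def by (intro tendsto_intros phase_odd_increment_tendsto[OF cont] step_spiral_ratio) simp
    then show "(\<lambda>i. (\<bar>k i - k (Suc i)\<bar> + \<bar>1 - ?r i\<bar> * B) / 2) \<longlonglongrightarrow> 0"
      by simp
    show "\<forall>\<^sub>F i in sequentially. norm (radial_sign i * k i - (Q (Suc i) - Q i) / step spiral i) \<le>
        (\<bar>k i - k (Suc i)\<bar> + \<bar>1 - ?r i\<bar> * B) / 2"
      using eventually_ge_at_top[of 2]
    proof eventually_elim
      case (elim i)
      have "radial_sign i * k i - (Q (Suc i) - Q i) / step spiral i =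
          radial_sign i / 2 * ((k i - k (Suc i)) + (1 - ?r i) * k (Suc i))"
        using spiral.step_pos[OF elim] by (simp add: Q_def radial_sign_Suc field_simps)
      also have "norm \<dots> = \<bar>(k i - k (Suc i)) + (1 - ?r i) * k (Suc i)\<bar> / 2"
        by (simp add: abs_mult)
      also have "\<bar>(k i - k (Suc i)) + (1 - ?r i) * k (Suc i)\<bar> \<le> \<bar>k i - k (Suc i)\<bar> + \<bar>1 - ?r i\<bar> * \<bar>k (Suc i)\<bar>"
        using abs_triangle_ineq[of "k i - k (Suc i)" "(1 - ?r i) * k (Suc i)"] by (simp only: abs_mult)
      also have "\<dots> \<le> \<bar>k i - k (Suc i)\<bar> + \<bar>1 - ?r i\<bar> * B"
        by (intro add_left_mono mult_left_mono k_le) simp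
      finally show ?case
        by simp
    qed
  qed
  from filterlim_compose[OF this spiral.piece_at_top]
  have "((\<lambda>t. radial_sign (?p t) * k (?p t) - \<tau> t) \<longlongrightarrow> 0) at_top"
    unfolding \<tau>_def .
  from tendsto_add[OF tendsto_along_curve[OF cont C] this]
  have lim: "((\<lambda>t. F t - h t - \<tau> t) \<longlongrightarrow> 0) at_top"
    by (simp add: F_def h_def k_def algebra_simps)
  have \<phi>_meas: "\<phi> \<in> borel_measurable borel"
    using cont by (rule borel_measurable_continuous_onI)
  have h_integral: "(h has_integral T * exp_average (phase_average \<phi>) (ln T + C)) {0..T}" if "0 < T" for T
    unfolding h_def
    by (rule has_integral_ln_average[OF continuous_phase_average[OF cont] phase_average_periodic
          abs_phase_average_le[OF B] that])
  have int: "F integrable_on {0..T}" "h integrable_on {0..T}" "\<tau> integrable_on {0..T}" if "0 < T" for T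
    using spiral.integral_curve_measure(1)[OF \<phi>_meas B that] h_integral[OF that]
      spiral.integrable_telescope[of T Q] that by (auto simp: F_def \<tau>_def)
  have "(\<lambda>t. F t - h t - \<tau> t) integrable_on {0..T}" if "0 \<le> T" for T
  proof (cases "T = 0")
    case True
    then show ?thesis
      using integrable_on_refl[of "\<lambda>t. F t - h t - \<tau> t" T] by simp
  next
    case False
    then show ?thesis
      using int[of T] that by (simp add: integrable_diff)
  qed
  from tendsto_average[OF this lim]
  have main: "((\<lambda>T. integral {0..T} (\<lambda>t. F t - h t - \<tau> t) / T) \<longlongrightarrow> 0) at_top" .
  obtain K where K: "\<And>i. \<bar>step spiral i\<bar> \<le> K"
    using convergent_imp_Bseq[OF convergentI[OF step_spiral_tendsto_0]] by (auto simp: Bseq_def)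
  have "\<bar>Q i\<bar> \<le> B * K" for i
  proof -
    have "\<bar>Q i\<bar> = \<bar>k i\<bar> * \<bar>step spiral i\<bar> / 2"
      by (simp add: Q_def abs_mult)
    also have "\<dots> \<le> \<bar>k i\<bar> * \<bar>step spiral i\<bar>"
      by simp
    also have "\<dots> \<le> B * K"
      by (intro mult_mono k_le K) (use \<open>0 \<le> B\<close> in auto)
    finally show ?thesis .
  qed
  then have "\<forall>\<^sub>F T in at_top. norm (integral {0..T} \<tau>) \<le> 4 * (B * K)"
    unfolding \<tau>_def real_norm_def
    by (intro eventually_mono[OF eventually_ge_at_top[of 0]] spiral.integral_telescope_bounded)
  then have "Bfun (\<lambda>T. integral {0..T} \<tau>) at_top"
    by (rule BfunI)
  moreover have "((\<lambda>T. inverse T) \<longlongrightarrow> (0::real)) at_top"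
    by (rule tendsto_inverse_0_at_top[OF filterlim_ident])
  ultimately have "((\<lambda>T. integral {0..T} \<tau> * inverse T) \<longlongrightarrow> 0) at_top"
    using bounded_bilinear.Bfun_prod_Zfun[OF bounded_bilinear_mult] by (auto simp: tendsto_Zfun_iff)
  from tendsto_add[OF main this]
  have "((\<lambda>T. integral {0..T} (\<lambda>t. F t - h t - \<tau> t) / T + integral {0..T} \<tau> * inverse T) \<longlongrightarrow> 0) at_top"
    by simp
  moreover have "\<forall>\<^sub>F T in at_top. integral {0..T} (\<lambda>t. F t - h t - \<tau> t) / T + integral {0..T} \<tau> * inverse T =
      (\<integral>z. \<phi> z \<partial>curve_measure (interp_curve spiral) {0..T}) - exp_average (phase_average \<phi>) (ln T + C)"
    using eventually_gt_at_top[of 0]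
  proof eventually_elim
    case (elim T)
    have "integral {0..T} (\<lambda>t. F t - h t - \<tau> t) = integral {0..T} F - integral {0..T} h - integral {0..T} \<tau>"
      using int[OF elim] by (simp add: integral_diff integrable_diff)
    moreover have "(\<integral>z. \<phi> z \<partial>curve_measure (interp_curve spiral) {0..T}) = integral {0..T} F / T"
      unfolding F_def by (rule spiral.integral_curve_measure(2)[OF \<phi>_meas B elim])
    ultimately show ?case
      using elim integral_unique[OF h_integral[OF elim]] by (simp add: field_simps)
  qed
  ultimately show ?thesis
    using tendsto_cong by fast
qed

section \<open>The limit points\<close>

text \<open>The index is shifted by one, so that the intervals \<open>{0..N}\<close> start with \<open>N = 1\<close>.\<close>

abbreviation spiral_measure :: "nat \<Rightarrow> ((real ^ 2) \<times> (real ^ 2)) measure" where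
  "spiral_measure n \<equiv> curve_measure (interp_curve spiral) {0..real (Suc n)}"

lemma limitin_spiral_measure:
  "limitin weak_star_topology (spiral_measure \<circ> s) M sequentially \<longleftrightarrow>
    sets M = sets borel \<and> finite_measure M \<and>
    (\<forall>\<phi>\<in>C\<^sub>0. (\<lambda>n. \<integral>z. \<phi> z \<partial>spiral_measure (s n)) \<longlonglongrightarrow> (\<integral>z. \<phi> z \<partial>M))"
proof (subst limitin_weak_star)
  fix n
  interpret prob_space "spiral_measure (s n)"
    by (rule spiral.prob_space_curve_measure) simp
  show "finite_measure ((spiral_measure \<circ> s) n)"
    unfolding o_def by (rule finite_measure_axioms)
qed (simp_all add: spiral.sets_curve_measure)

lemma isCont_exp_average:
  assumes "continuous_on UNIV \<phi>"
  shows "isCont (exp_average (phase_average \<phi>)) x"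
  by (rule DERIV_isCont[OF DERIV_exp_average[OF continuous_phase_average[OF assms] phase_average_periodic]])

text \<open>Whenever \<open>ln (s n + 1) + C\<close> approaches \<open>\<theta>\<^sub>0\<close> modulo \<open>2\<pi>\<close>, the curve measures approach the
  limit measure with parameter \<open>\<theta>\<^sub>0\<close>. The number of full turns is the difference of the natural
  numbers \<open>m n\<close> and \<open>l n\<close>, so it may be negative.\<close>

lemma tendsto_spiral_measure:
  assumes C: "(\<lambda>n. angle n - ln (knot spiral n)) \<longlonglongrightarrow> C"
    and s: "filterlim s at_top sequentially"
    and lim: "(\<lambda>n. ln (real (Suc (s n))) + C + 2 * pi * real (m n) - 2 * pi * real (l n)) \<longlonglongrightarrow> \<theta>\<^sub>0"
    and \<phi>: "\<phi> \<in> C\<^sub>0"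
  shows "(\<lambda>n. \<integral>z. \<phi> z \<partial>spiral_measure (s n)) \<longlonglongrightarrow> (\<integral>z. \<phi> z \<partial>limit_measure \<theta>\<^sub>0)"
proof -
  have cont: "continuous_on UNIV \<phi>"
    using \<phi> by (simp add: C\<^sub>0_def)
  obtain B where B: "\<And>z. \<bar>\<phi> z\<bar> \<le> B"
    using C\<^sub>0_bounded[OF \<phi>] by blast
  let ?G = "exp_average (phase_average \<phi>)"
  note periodic = exp_average_periodic_nat[OF continuous_phase_average[OF cont] phase_average_periodic]
  have G: "?G (y + 2 * pi * real i - 2 * pi * real j) = ?G y" for y i j
    using periodic[of "y + 2 * pi * real i - 2 * pi * real j" j] periodic[of y i] by simp
  have "filterlim (\<lambda>n. real (Suc (s n))) at_top sequentially"
    by (rule filterlim_compose[OF filterlim_real_sequentially filterlim_compose[OF filterlim_Suc s]])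
  from filterlim_compose[OF tendsto_curve_average[OF cont B C] this]
  have "(\<lambda>n. (\<integral>z. \<phi> z \<partial>spiral_measure (s n)) - ?G (ln (real (Suc (s n))) + C)) \<longlonglongrightarrow> 0" .
  moreover have "(\<lambda>n. ?G (ln (real (Suc (s n))) + C)) \<longlonglongrightarrow> ?G \<theta>\<^sub>0"
    using isCont_tendsto_compose[OF isCont_exp_average[OF cont] lim] by (simp only: G)
  ultimately have "(\<lambda>n. ((\<integral>z. \<phi> z \<partial>spiral_measure (s n)) - ?G (ln (real (Suc (s n))) + C)) +
      ?G (ln (real (Suc (s n))) + C)) \<longlonglongrightarrow> 0 + ?G \<theta>\<^sub>0"
    by (rule tendsto_add)
  then show ?thesis
    using integral_limit_measure[OF borel_measurable_continuous_onI[OF cont] B] by simp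
qed

lemma limit_points_subset:
  assumes "M \<in> limit_points weak_star_topology spiral_measure"
  shows "\<exists>\<theta>\<^sub>0. M = limit_measure \<theta>\<^sub>0"
proof -
  obtain C where C: "(\<lambda>n. angle n - ln (knot spiral n)) \<longlonglongrightarrow> C"
    by (rule angle_knot_convergent)
  obtain s where s: "strict_mono s" and M: "sets M = sets borel" "finite_measure M"
    and lim: "\<And>\<phi>. \<phi> \<in> C\<^sub>0 \<Longrightarrow> (\<lambda>n. \<integral>z. \<phi> z \<partial>spiral_measure (s n)) \<longlonglongrightarrow> (\<integral>z. \<phi> z \<partial>M)"
    using assms unfolding limit_points_def limitin_spiral_measure by blast
  (* Reduce the parameters to one period and pass to a convergent subsequence. *)
  let ?y = "\<lambda>n. ln (real (Suc (s n))) + C"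
  define f where "f = (\<lambda>n. \<lfloor>?y n / (2 * pi)\<rfloor>)"
  have "?y n - 2 * pi * f n \<in> {0..2 * pi}" for n
  proof -
    have "f n * (2 * pi) \<le> ?y n" "?y n < (f n + 1) * (2 * pi)"
      unfolding f_def using floor_divide_lower[of "2 * pi" "?y n"] floor_divide_upper[of "2 * pi" "?y n"]
      by simp_all
    then show ?thesis
      by (simp add: algebra_simps)
  qed
  then obtain \<theta>\<^sub>0 r where r: "strict_mono r" "((\<lambda>n. ?y n - 2 * pi * f n) \<circ> r) \<longlonglongrightarrow> \<theta>\<^sub>0"
    using compact_Icc[of 0 "2 * pi", unfolded compact_def, rule_format, of "\<lambda>n. ?y n - 2 * pi * f n"] by blast
  have "2 * pi * real_of_int i = 2 * pi * real (nat i) - 2 * pi * real (nat (- i))" for i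
    by (cases "0 \<le> i") auto
  then have "(\<lambda>n. ?y (r n) + 2 * pi * real (nat (- f (r n))) - 2 * pi * real (nat (f (r n)))) =
      (\<lambda>n. ?y n - 2 * pi * f n) \<circ> r"
    by (simp add: fun_eq_iff)
  then have lim': "(\<lambda>n. ?y (r n) + 2 * pi * real (nat (- f (r n))) - 2 * pi * real (nat (f (r n)))) \<longlonglongrightarrow> \<theta>\<^sub>0"
    using r(2) by simp
  have sr: "filterlim (\<lambda>n. s (r n)) at_top sequentially"
    using filterlim_subseq[OF strict_mono_o[OF s r(1)]] by (simp add: o_def)
  have "M = limit_measure \<theta>\<^sub>0"
  proof (rule finite_measure_eqI_C\<^sub>0[OF M sets_limit_measure finite_measure_limit_measure])
    fix \<phi> :: "(real ^ 2) \<times> (real ^ 2) \<Rightarrow> real" assume \<phi>: "\<phi> \<in> C\<^sub>0"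
    show "(\<integral>z. \<phi> z \<partial>M) = (\<integral>z. \<phi> z \<partial>limit_measure \<theta>\<^sub>0)"
      using LIMSEQ_subseq_LIMSEQ[OF lim[OF \<phi>] r(1)] tendsto_spiral_measure[OF C sr lim' \<phi>]
      by (intro LIMSEQ_unique) (simp_all add: o_def)
  qed
  then show ?thesis ..
qed

lemma limit_measure_mem_limit_points:
  "limit_measure \<theta>\<^sub>0 \<in> limit_points weak_star_topology spiral_measure"
proof -
  obtain C where C: "(\<lambda>n. angle n - ln (knot spiral n)) \<longlonglongrightarrow> C"
    by (rule angle_knot_convergent)
  obtain m :: nat where m: "C - \<theta>\<^sub>0 < real m * (2 * pi)"
    using reals_Archimedean3[of "2 * pi"] pi_gt_zero by auto
  (* The times at which ln t + C equals the given parameter modulo 2 pi; the turns before m are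
     skipped so that all these times are at least 1. *)
  define E where "E = (\<lambda>n. exp (\<theta>\<^sub>0 - C + 2 * pi * real (m + n)))"
  define s where "s = (\<lambda>n. nat \<lfloor>E n\<rfloor>)"
  have E_ge: "1 \<le> E n" for n
  proof -
    have "\<theta>\<^sub>0 - C + 2 * pi * real (m + n) = (real m * (2 * pi) - (C - \<theta>\<^sub>0)) + 2 * pi * real n"
      by (simp add: algebra_simps)
    also have "\<dots> \<ge> 0"
      using m by (intro add_nonneg_nonneg) auto
    finally show ?thesis
      by (simp add: E_def)
  qed
  have E_Suc: "E n + 1 \<le> E (Suc n)" for n
  proof -
    have "2 \<le> exp (2 * pi)"
      using exp_ge_add_one_self[of "2 * pi"] pi_gt3 by linarith
    then have "E n * 2 \<le> E n * exp (2 * pi)"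
      using E_ge[of n] by (intro mult_left_mono) auto
    also have "\<dots> = E (Suc n)"
      by (simp add: E_def exp_add[symmetric] algebra_simps)
    finally show ?thesis
      using E_ge[of n] by simp
  qed
  have s_E: "E n < real (Suc (s n))" "real (Suc (s n)) \<le> E n + 1" for n
    using E_ge[of n] by (simp_all add: s_def) linarith+
  have "strict_mono s"
    unfolding strict_mono_Suc_iff
  proof
    fix n
    have "\<lfloor>E n\<rfloor> + 1 \<le> \<lfloor>E (Suc n)\<rfloor>"
      using floor_mono[OF E_Suc[of n]] by simp
    moreover have "0 \<le> \<lfloor>E n\<rfloor>"
      using E_ge[of n] by simp
    ultimately show "s n < s (Suc n)"
      unfolding s_def by linarith
  qed
  have ln_E: "ln (E n) = \<theta>\<^sub>0 - C + 2 * pi * real (m + n)" for n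
    by (simp add: E_def)
  have "filterlim (\<lambda>n. \<theta>\<^sub>0 - C + 2 * pi * real (m + n)) at_top sequentially"
    by (intro filterlim_tendsto_add_at_top[OF tendsto_const]
        filterlim_tendsto_pos_mult_at_top[OF tendsto_const _ filterlim_compose[OF filterlim_real_sequentially]])
       (simp_all add: filterlim_add_const_nat_at_top add.commute[of m])
  then have "filterlim E at_top sequentially"
    unfolding E_def by (rule filterlim_compose[OF exp_at_top])
  then have inv_E: "(\<lambda>n. inverse (E n)) \<longlonglongrightarrow> 0"
    by (rule tendsto_inverse_0_at_top)
  have "(\<lambda>n. ln (real (Suc (s n))) - ln (E n)) \<longlonglongrightarrow> 0"
  proof (rule Lim_null_comparison[OF always_eventually inv_E], rule allI)
    fix n
    have "ln (real (Suc (s n))) \<le> ln (E n + 1)"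
      using s_E[of n] E_ge[of n] by (intro ln_mono) auto
    also have "ln (E n + 1) = ln (E n) + ln (1 + inverse (E n))"
    proof -
      have "E n + 1 = E n * (1 + inverse (E n))"
        using E_ge[of n] by (simp add: distrib_left)
      moreover have "0 < E n" "0 < 1 + inverse (E n)"
        using E_ge[of n] by (auto intro!: add_pos_pos)
      ultimately show ?thesis
        by (simp add: ln_mult_pos)
    qed
    also have "ln (1 + inverse (E n)) \<le> inverse (E n)"
      using E_ge[of n] by (intro ln_add_one_self_le_self) simp
    finally have "ln (real (Suc (s n))) - ln (E n) \<le> inverse (E n)"
      by simp
    moreover have "ln (E n) \<le> ln (real (Suc (s n)))"
      using s_E[of n] E_ge[of n] by (intro ln_mono) auto
    ultimately show "norm (ln (real (Suc (s n))) - ln (E n)) \<le> inverse (E n)"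
      by simp
  qed
  then have "(\<lambda>n. (ln (real (Suc (s n))) - ln (E n)) + \<theta>\<^sub>0) \<longlonglongrightarrow> 0 + \<theta>\<^sub>0"
    by (intro tendsto_intros)
  then have lim: "(\<lambda>n. ln (real (Suc (s n))) + C + 2 * pi * real 0 - 2 * pi * real (m + n)) \<longlonglongrightarrow> \<theta>\<^sub>0"
    by (simp add: ln_E algebra_simps)
  have "limitin weak_star_topology (spiral_measure \<circ> s) (limit_measure \<theta>\<^sub>0) sequentially"
    unfolding limitin_spiral_measure
    using tendsto_spiral_measure[OF C filterlim_subseq[OF \<open>strict_mono s\<close>] lim]
    by (simp add: finite_measure_limit_measure)
  then show ?thesis
    unfolding limit_points_def using \<open>strict_mono s\<close> by blast
qed

text \<open>If the exponential averages \<open>G\<close> of the cosine were constant, the differential equation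
  \<open>G' = g - G\<close> would make the cosine constant. So integration of a function that restricts to the
  cosine maps the limit measures onto a nondegenerate interval.\<close>

lemma uncountable_limit_measures: "uncountable (range limit_measure)"
proof
  assume count: "countable (range limit_measure)"
  (* The clipping makes the function bounded and has no effect on the unit circle. *)
  define \<phi> :: "(real ^ 2) \<times> (real ^ 2) \<Rightarrow> real" where "\<phi> = (\<lambda>z. max (- 1) (min 1 (fst z $ 1)))"
  let ?G = "exp_average (phase_average \<phi>)"
  have cont: "continuous_on UNIV \<phi>"
    unfolding \<phi>_def by (intro continuous_intros)
  have B: "\<bar>\<phi> z\<bar> \<le> 1" for z
    unfolding \<phi>_def by linarith
  have cos: "phase_average \<phi> = cos"
    by (auto simp: fun_eq_iff phase_average_def \<phi>_def unit_vec_def)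
  have "range ?G = (\<lambda>M. \<integral>z. \<phi> z \<partial>M) ` range limit_measure"
    using integral_limit_measure[OF borel_measurable_continuous_onI[OF cont] B] by (simp add: image_image)
  then have "countable (range ?G)"
    using count by simp
  moreover have "connected (range ?G)"
    using isCont_exp_average[OF cont]
    by (intro connected_continuous_image continuous_at_imp_continuous_on) auto
  ultimately have "?G x = ?G 0" for x
    using connected_uncountable[of "range ?G" "?G x" "?G 0"] by auto
  then have "?G = (\<lambda>_. ?G 0)"
    by auto
  then have "cos x - ?G 0 = 0" for x
    using DERIV_exp_average[OF continuous_phase_average[OF cont] phase_average_periodic, of x]
    unfolding cos by (metis DERIV_const DERIV_unique)
  from this[of 0] this[of pi] show False
    by simp
qed

theorem mainTheorem3:
  shows "limit_points weak_star_topology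
           (\<lambda>n. curve_measure (interp_curve spiral) {0..real (Suc n)}) =
         {limit_measure \<theta>\<^sub>0 | \<theta>\<^sub>0. \<theta>\<^sub>0 \<in> UNIV}
       \<and> uncountable (limit_points weak_star_topology
           (\<lambda>n. curve_measure (interp_curve spiral) {0..real (Suc n)}))"
proof -
  have "limit_points weak_star_topology spiral_measure = range limit_measure"
    using limit_points_subset limit_measure_mem_limit_points by blast
  then show ?thesis
    using uncountable_limit_measures by (simp add: full_SetCompr_eq)
qed

end
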